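(* Let $q=e^{2\pi i\tau}$ with $\tau$ in the upper half-plane, and let $$x = q\frac{(q^2;q^2)_{\infty}(q^{10};q^{10})_{\infty}^3}{(q;q)_{\infty}^3(q^5;q^5)_{\infty}},\qquad y = q^2\frac{(q^2;q^2)_{\infty}^2(q^4;q^4)_{\infty}(q^5;q^5)_{\infty}(q^{20};q^{20})_{\infty}^3}{(q;q)_{\infty}^5(q^{10};q^{10})_{\infty}^2},$$ viewed as functions of $\tau$. Let $W=\begin{pmatrix}4&-1\\100&-24\end{pmatrix}$ act by $W\tau=\frac{4\tau-1}{100\tau-24}$. Let $f = y^j \frac{x^m}{(1+5x)^n}$ with $j\in\{0,1\}$ and $m,n\in\mathbb{Z}_{\ge 0}$. Then $$f(W\tau) = (-1)^{m+n} 4^{n-2j-m}\frac{\left( 1+4x \right)^j\left(1 + 10x + 20y\right)^j \left(1 + 10x + 20x^2 + 4y\right)^m \left(1 + 5x + 5y\right)^n}{(1+5x)^{3j+2m+n}},$$ where $x,y$ on the right-hand side are evaluated at $\tau$.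
   Context: $(q^a;q^b)_{\infty} = \prod_{m\ge 0}(1-q^{bm+a})$. The functions $x$ and $y$ are eta quotients and modular functions for $\Gamma_0(20)$; $W$ is an Atkin--Lehner involution of level $20$ (up to scaling). *)

theory Defs
  imports "HOL-Complex_Analysis.Complex_Analysis"
begin

definition q_of :: "complex \<Rightarrow> complex" where
  "q_of \<tau> = exp (2 * complex_of_real pi * \<i> * \<tau>)"

text \<open>\<^term>\<open>qpoch a b q\<close> is the infinite product usually written $(q^a;q^b)_\infty$: the first two
  arguments are exponents of \<open>q\<close>. For \<open>norm q < 1\<close> and \<open>b > 0\<close> the product converges.\<close>

definition qpoch :: "nat \<Rightarrow> nat \<Rightarrow> complex \<Rightarrow> complex" where
  "qpoch a b q = (\<Prod>m. 1 - q ^ (b * m + a))"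

definition x_fun :: "complex \<Rightarrow> complex" where
  "x_fun \<tau> = (let q = q_of \<tau> in
     q * (qpoch 2 2 q * qpoch 10 10 q ^ 3) / (qpoch 1 1 q ^ 3 * qpoch 5 5 q))"

definition y_fun :: "complex \<Rightarrow> complex" where
  "y_fun \<tau> = (let q = q_of \<tau> in
     q ^ 2 * (qpoch 2 2 q ^ 2 * qpoch 4 4 q * qpoch 5 5 q * qpoch 20 20 q ^ 3)
       / (qpoch 1 1 q ^ 5 * qpoch 10 10 q ^ 2))"

text \<open>The action of the matrix with rows $(4,-1)$ and $(100,-24)$, of determinant $4$.\<close>

definition W :: "complex \<Rightarrow> complex" where
  "W \<tau> = (4 * \<tau> - 1) / (100 * \<tau> - 24)"

end

(* Write q = exp (2 pi i tau) and let A(tau) be the eta quotient (q;q)^5 / (q^5;q^5), of weight 2.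
   The identity of elliptic functions
     wp(w) - wp(v) = theta'(0)^2 theta(w + v) theta(w - v) / (theta(w)^2 theta(v)^2),  wp = (log theta)'',
   evaluated at w = 1/5, v = 2/5 shows that A(tau) is a constant multiple of wp(1/5) - wp(2/5).
   Since wp is determined up to an additive constant by its lattice, A transforms under matrices
   (a b; c d) with 5 | c with weight 2 and the quadratic character of d modulo 5.
   Factoring theta over even and odd exponents of q gives, by the same identity for the lattice
   generated by 1 and 2 tau, the two formulas
     5 x A(tau) = A(2 tau) - A(tau)  and  5 y A(tau) = A(4 tau) - A(2 tau);
   comparing q with -q gives A(tau) + A(tau + 1/2) = 4 A(4 tau) - 2 A(2 tau), where
   A(tau) A(tau + 1/2) A(4 tau) = A(2 tau)^3. This is the equation of the curve X_0(20).
   Up to common factors, W exchanges A(tau) and A(4 tau) and fixes A(2 tau) with a sign,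
   so the claim reduces to algebra in A(tau), A(2 tau), A(4 tau). *)
theory Submission
  imports Defs
begin

section \<open>Elliptic functions with poles on the lattice\<close>

definition lattice :: "complex \<Rightarrow> complex set" where
  "lattice \<tau> = {of_int m + of_int n * \<tau> |m n. True}"

lemma lattice_0 [simp]: "0 \<in> lattice \<tau>"
  unfolding lattice_def by (auto intro!: exI[of _ 0])

lemma lattice_add: "v \<in> lattice \<tau> \<Longrightarrow> w \<in> lattice \<tau> \<Longrightarrow> v + w \<in> lattice \<tau>"
proof -
  assume "v \<in> lattice \<tau>" "w \<in> lattice \<tau>"
  then obtain a b c d where "v = of_int a + of_int b * \<tau>" "w = of_int c + of_int d * \<tau>"
    unfolding lattice_def by blast
  then have "v + w = of_int (a + c) + of_int (b + d) * \<tau>" by (simp add: algebra_simps)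
  then show ?thesis unfolding lattice_def by blast
qed

lemma lattice_uminus: "w \<in> lattice \<tau> \<Longrightarrow> - w \<in> lattice \<tau>"
proof -
  assume "w \<in> lattice \<tau>"
  then obtain c d where "w = of_int c + of_int d * \<tau>" unfolding lattice_def by blast
  then have "- w = of_int (- c) + of_int (- d) * \<tau>" by (simp add: algebra_simps)
  then show ?thesis unfolding lattice_def by blast
qed

lemma lattice_uminus_iff [simp]: "- w \<in> lattice \<tau> \<longleftrightarrow> w \<in> lattice \<tau>"
  using lattice_uminus[of w] lattice_uminus[of "- w"] by auto

lemma lattice_add_iff: "v \<in> lattice \<tau> \<Longrightarrow> w + v \<in> lattice \<tau> \<longleftrightarrow> w \<in> lattice \<tau>"
  using lattice_add[of w \<tau> v] lattice_add[of "w + v" \<tau> "- v"] lattice_uminus[of v] by auto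

lemma lattice_basis: "of_int m + of_int n * \<tau> \<in> lattice \<tau>"
  unfolding lattice_def by blast

lemma lattice_1 [simp]: "1 \<in> lattice \<tau>" and lattice_tau [simp]: "\<tau> \<in> lattice \<tau>"
  using lattice_basis[of 1 0 \<tau>] lattice_basis[of 0 1 \<tau>] by simp_all

text \<open>Discreteness: the imaginary part excludes every nonzero multiple of
  \<open>\<tau>\<close>, and an integer of norm below 1 is 0.\<close>

lemma lattice_small:
  assumes "w \<in> lattice \<tau>" "norm w < min 1 (Im \<tau>)"
  shows "w = 0"
proof -
  obtain m n where w: "w = of_int m + of_int n * \<tau>" using assms(1) unfolding lattice_def by blast
  have pos: "Im \<tau> > 0" using assms(2) norm_ge_zero[of w] by linarith
  have "\<bar>of_int n\<bar> * Im \<tau> = \<bar>Im w\<bar>" using pos by (simp add: w abs_mult)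
  also have "\<dots> < 1 * Im \<tau>" using abs_Im_le_cmod[of w] assms(2) by simp
  finally have n: "n = 0" using pos by (simp only: mult_less_cancel_right) auto
  then have "\<bar>real_of_int m\<bar> < 1" using assms(2) by (simp add: w)
  then have "m = 0" by linarith
  with n show ?thesis by (simp add: w)
qed

lemma closed_lattice: "Im \<tau> > 0 \<Longrightarrow> closed (lattice \<tau>)"
proof (rule discrete_imp_closed[of "min 1 (Im \<tau>)"])
  show "\<forall>x\<in>lattice \<tau>. \<forall>y\<in>lattice \<tau>. dist y x < min 1 (Im \<tau>) \<longrightarrow> y = x"
    using lattice_small[of "_ - _" \<tau>] lattice_add lattice_uminus
    by (metis (no_types, lifting) diff_conv_add_uminus dist_norm eq_iff_diff_eq_0)
qed auto

text \<open>Subtracting a multiple of \<open>\<tau>\<close> and then an integer moves every point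
  into one rectangle, whose compactness later bounds doubly periodic functions.\<close>

lemma lattice_reduce:
  assumes "Im \<tau> > 0"
  obtains l where "l \<in> lattice \<tau>" "w - l \<in> cbox 0 (Complex 1 (Im \<tau>))"
proof
  define n where "n = \<lfloor>Im w / Im \<tau>\<rfloor>"
  define m where "m = \<lfloor>Re (w - of_int n * \<tau>)\<rfloor>"
  show "of_int m + of_int n * \<tau> \<in> lattice \<tau>" by (rule lattice_basis)
  have "of_int n \<le> Im w / Im \<tau>" "Im w / Im \<tau> \<le> of_int n + 1"
    unfolding n_def by linarith+
  then have "of_int n * Im \<tau> \<le> Im w" "Im w \<le> (of_int n + 1) * Im \<tau>"
    using assms by (simp_all add: field_simps)
  moreover have "of_int m \<le> Re (w - of_int n * \<tau>)" "Re (w - of_int n * \<tau>) \<le> of_int m + 1"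
    unfolding m_def by linarith+
  ultimately show "w - (of_int m + of_int n * \<tau>) \<in> cbox 0 (Complex 1 (Im \<tau>))"
    by (simp add: in_cbox_complex_iff algebra_simps)
qed

text \<open>The functions of interest carry no meaning at lattice points, so periods are only
  assumed off the lattice; the orbit of a point off the lattice never meets it.\<close>

lemma lattice_periodic:
  assumes p1: "\<And>w. w \<notin> lattice \<tau> \<Longrightarrow> f (w + 1) = f w"
    and p2: "\<And>w. w \<notin> lattice \<tau> \<Longrightarrow> f (w + \<tau>) = f w"
    and l: "l \<in> lattice \<tau>" and w: "w \<notin> lattice \<tau>"
  shows "f (w + l) = f w"
proof -
  have *: "f (w + of_int n * p) = f w"
    if p: "\<And>w. w \<notin> lattice \<tau> \<Longrightarrow> f (w + p) = f w" "p \<in> lattice \<tau>" and w: "w \<notin> lattice \<tau>" for n p w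
  proof -
    have np: "of_int n * p \<in> lattice \<tau>" for n
    proof -
      obtain a b where "p = of_int a + of_int b * \<tau>" using p(2) unfolding lattice_def by blast
      then have "of_int n * p = of_int (n * a) + of_int (n * b) * \<tau>" by (simp add: algebra_simps)
      then show ?thesis unfolding lattice_def by blast
    qed
    have step: "f (w + of_int (n + 1) * p) = f (w + of_int n * p)" for n
      using p(1)[of "w + of_int n * p"] w lattice_add_iff[OF np, of w n] by (simp add: algebra_simps)
    show ?thesis
    proof (induction n rule: int_induct[of _ 0])
      case (step2 i)
      then show ?case using step[of "i - 1"] by simp
    qed (use step in simp_all)
  qed
  obtain m n where l: "l = of_int m + of_int n * \<tau>" using l unfolding lattice_def by blast
  have "w + of_int m \<notin> lattice \<tau>" using lattice_add_iff[OF lattice_basis[of m 0 \<tau>], of w] w by simp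
  then have "f (w + of_int m + of_int n * \<tau>) = f (w + of_int m)" using * p2 by simp
  also have "\<dots> = f w" using *[of 1 w m] p1 w by simp
  finally show ?thesis by (simp add: l add.assoc)
qed

text \<open>The limit alone still allows a simple pole. Evenness excludes it:
  \<open>w\<^sup>2 * f w\<close> extends to an even holomorphic function whose value and first
  derivative at 0 vanish, so \<open>w\<close> can be divided out twice.\<close>

lemma even_removable:
  assumes r: "r > 0" and hol: "f holomorphic_on ball 0 r - {0}"
    and even: "\<And>w. w \<in> ball 0 r - {0} \<Longrightarrow> f (- w) = f w"
    and lim: "((\<lambda>w. w\<^sup>2 * f w) \<longlongrightarrow> 0) (at 0)"
  obtains h where "h holomorphic_on ball 0 r" "\<And>w. w \<in> ball 0 r - {0} \<Longrightarrow> h w = f w"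
proof -
  define g where "g = (\<lambda>w. if w = 0 then 0 else w\<^sup>2 * f w)"
  have g_hol: "g holomorphic_on ball 0 r"
    unfolding g_def by (rule removable_singularity[OF _ _ lim]) (auto intro!: holomorphic_intros hol)
  have dg: "deriv g 0 = 0"
  proof -
    have D: "(g has_field_derivative deriv g 0) (at 0)"
      using g_hol r by (auto intro!: holomorphic_derivI[of _ "ball 0 r"])
    have "((\<lambda>w. g (- w)) has_field_derivative - deriv g 0) (at 0)"
      using DERIV_chain2[of g "deriv g 0" uminus 0 "-1" UNIV] D
      by (simp add: DERIV_minus[OF DERIV_ident])
    moreover have "((\<lambda>w. g (- w)) has_field_derivative deriv g 0) (at 0)"
      by (rule has_field_derivative_transform_within_open[OF D, of "ball 0 r"])
         (use r even in \<open>auto simp: g_def\<close>)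
    ultimately show ?thesis using DERIV_unique by fastforce
  qed
  define g1 where "g1 = (\<lambda>w. if w = 0 then deriv g 0 else w * f w)"
  have g1_hol: "g1 holomorphic_on ball 0 r"
    by (rule pole_theorem_open_0[OF g_hol, of 0]) (auto simp: g1_def g_def power2_eq_square)
  have "(\<lambda>w. if w = 0 then deriv g1 0 else f w) holomorphic_on ball 0 r"
    by (rule pole_theorem_open_0[OF g1_hol, of 0]) (auto simp: g1_def dg)
  then show ?thesis by (rule that) auto
qed

text \<open>An application of Liouville's theorem. Two even functions with the same periods and the
  same leading coefficient at a double pole differ by such an \<open>f\<close>; the later identities
  for \<open>wp\<close> are proved in this way.\<close>

lemma even_elliptic_constant:
  assumes \<tau>: "Im \<tau> > 0" and hol: "f holomorphic_on - lattice \<tau>"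
    and p1: "\<And>w. w \<notin> lattice \<tau> \<Longrightarrow> f (w + 1) = f w"
    and p2: "\<And>w. w \<notin> lattice \<tau> \<Longrightarrow> f (w + \<tau>) = f w"
    and even: "\<And>w. w \<notin> lattice \<tau> \<Longrightarrow> f (- w) = f w"
    and lim: "((\<lambda>w. w\<^sup>2 * f w) \<longlongrightarrow> 0) (at 0)"
  obtains K where "\<And>w. w \<notin> lattice \<tau> \<Longrightarrow> f w = K"
proof -
  define r where "r = min 1 (Im \<tau>)"
  have r: "r > 0" using \<tau> by (simp add: r_def)
  have ball_lattice: "w \<notin> lattice \<tau>" if "w \<in> ball 0 r - {0}" for w
    using that lattice_small[of w \<tau>] by (auto simp: r_def)
  obtain h where h: "h holomorphic_on ball 0 r" "\<And>w. w \<in> ball 0 r - {0} \<Longrightarrow> h w = f w"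
  proof (rule even_removable[OF r _ _ lim])
    show "f holomorphic_on ball 0 r - {0}"
      by (rule holomorphic_on_subset[OF hol]) (use ball_lattice in auto)
  qed (use even ball_lattice in auto)
  have per: "f (w + l) = f w" if "l \<in> lattice \<tau>" "w \<notin> lattice \<tau>" for w l
    using lattice_periodic[of \<tau> f l w] p1 p2 that by blast
  \<comment> \<open>Every lattice point is a translate of 0, so the single value \<open>h 0\<close>
    fills all removable singularities at once.\<close>
  define F where "F = (\<lambda>w. if w \<in> lattice \<tau> then h 0 else f w)"
  have F_per: "F (w + l) = F w" if "l \<in> lattice \<tau>" for w l
    using lattice_add_iff[OF that, of w] per[OF that] by (simp add: F_def)
  have F_hol0: "F holomorphic_on ball 0 r"
  proof (rule holomorphic_transform[OF h(1)])
    show "h w = F w" if "w \<in> ball 0 r" for w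
      using that h(2)[of w] ball_lattice[of w] by (cases "w = 0") (simp_all add: F_def)
  qed
  have open_c: "open (- lattice \<tau>)" using closed_lattice[OF \<tau>] by (simp add: open_Compl)
  have "F analytic_on {w}" for w
  proof (cases "w \<in> lattice \<tau>")
    case True
    have "F holomorphic_on ball w r"
    proof (rule holomorphic_transform)
      show "(\<lambda>z. F (z - w)) holomorphic_on ball w r"
        by (rule holomorphic_on_compose_gen[OF _ F_hol0, unfolded o_def])
           (auto intro!: holomorphic_intros simp: dist_norm norm_minus_commute)
      show "F (z - w) = F z" for z using F_per[OF True, of "z - w"] by simp
    qed
    then show ?thesis using r by (auto simp: analytic_at_ball)
  next
    case False
    have "F holomorphic_on - lattice \<tau>"
      by (rule holomorphic_transform[OF hol]) (auto simp: F_def)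
    then show ?thesis using open_c False by (auto simp: analytic_at)
  qed
  then have F_hol: "F holomorphic_on UNIV"
    by (simp add: analytic_on_analytic_at[of F UNIV] flip: analytic_on_open)
  have "compact (F ` cbox 0 (Complex 1 (Im \<tau>)))"
    by (intro compact_continuous_image compact_cbox holomorphic_on_imp_continuous_on
        holomorphic_on_subset[OF F_hol]) auto
  moreover have "range F \<subseteq> F ` cbox 0 (Complex 1 (Im \<tau>))"
  proof
    fix y assume "y \<in> range F"
    then obtain w where y: "y = F w" by blast
    obtain l where l: "l \<in> lattice \<tau>" "w - l \<in> cbox 0 (Complex 1 (Im \<tau>))" using lattice_reduce[OF \<tau>] by blast
    then show "y \<in> F ` cbox 0 (Complex 1 (Im \<tau>))" using F_per[OF l(1), of "w - l"] y by force
  qed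
  ultimately have "bounded (range F)" using bounded_subset compact_imp_bounded by blast
  then obtain K where "\<And>w. F w = K"
    using Liouville_theorem[OF F_hol] by (auto simp: constant_on_def)
  then show ?thesis using that[of K] by (simp add: F_def) metis
qed

section \<open>Infinite q-products\<close>

text \<open>The classical (u; q)_infinity. Its first argument is free, not a power of
  \<open>q\<close> as in \<open>qpoch\<close>, so that it can be studied as a function of
  \<open>u\<close>.\<close>

definition qpochhammer :: "complex \<Rightarrow> complex \<Rightarrow> complex" where
  "qpochhammer u q = (\<Prod>n. 1 - u * q ^ n)"

lemma qpoch_eq_qpochhammer: "qpoch a b q = qpochhammer (q ^ a) (q ^ b)"
  by (simp add: qpoch_def qpochhammer_def power_add power_mult mult.commute[of _ "q ^ a"])

lemma convergent_qpochhammer: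
  fixes u q :: complex
  assumes "norm q < 1"
  shows "convergent_prod (\<lambda>n. 1 - u * q ^ n)"
proof -
  have "summable (\<lambda>n. norm u * norm q ^ n)"
    using assms by (intro summable_mult summable_geometric) auto
  then have "summable (\<lambda>n. norm ((1 - u * q ^ n) - 1))"
    by (simp add: norm_mult norm_power)
  then have "abs_convergent_prod (\<lambda>n. 1 - u * q ^ n)"
    by (rule summable_imp_abs_convergent_prod)
  then show ?thesis
    by (rule abs_convergent_prod_imp_convergent_prod)
qed

lemma qpochhammer_LIMSEQ:
  assumes "norm q < 1"
  shows "(\<lambda>N. \<Prod>n<N. 1 - u * q ^ n) \<longlonglongrightarrow> qpochhammer u q"
  unfolding qpochhammer_def
  using convergent_prod_has_prod[OF convergent_qpochhammer[OF assms]] by (rule has_prod_imp_tendsto')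

lemma qpochhammer_unique:
  assumes "norm q < 1" and "(\<lambda>N. \<Prod>n<N. 1 - u * q ^ n) \<longlonglongrightarrow> l"
  shows "qpochhammer u q = l"
  using LIMSEQ_unique[OF qpochhammer_LIMSEQ[OF assms(1)] assms(2)] .

lemma qpochhammer_eq_0_iff:
  assumes "norm q < 1"
  shows "qpochhammer u q = 0 \<longleftrightarrow> (\<exists>n. u * q ^ n = 1)"
  using has_prod_eq_0_iff[OF convergent_prod_has_prod[OF convergent_qpochhammer[OF assms, of u]]]
  unfolding qpochhammer_def by (auto simp: image_iff)

lemma qpochhammer_self_nonzero:
  assumes "norm q < 1"
  shows "qpochhammer q q \<noteq> 0"
proof -
  have "norm (q * q ^ n) < 1" for n
    using assms power_less_one_iff[of "norm q" "Suc n"] by (simp add: norm_mult norm_power)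
  then show ?thesis
    using assms by (metis less_irrefl norm_one qpochhammer_eq_0_iff)
qed

lemma qpochhammer_Suc:
  assumes "norm q < 1"
  shows "qpochhammer u q = (1 - u) * qpochhammer (u * q) q"
proof (rule qpochhammer_unique[OF assms])
  have "(\<lambda>N. (1 - u) * (\<Prod>n<N. 1 - u * q * q ^ n)) \<longlonglongrightarrow> (1 - u) * qpochhammer (u * q) q"
    by (intro tendsto_mult tendsto_const qpochhammer_LIMSEQ assms)
  then show "(\<lambda>N. \<Prod>n<N. 1 - u * q ^ n) \<longlonglongrightarrow> (1 - u) * qpochhammer (u * q) q"
    by (subst filterlim_sequentially_Suc[symmetric])
       (simp add: prod.lessThan_Suc_shift mult.assoc del: prod.lessThan_Suc)
qed

lemma norm_power_less_1:
  fixes q :: complex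
  assumes "norm q < 1" "k > 0"
  shows "norm (q ^ k) < 1"
  using assms power_less_one_iff[of "norm q" k] by (simp add: norm_power)

lemma qpochhammer_split:
  assumes "norm q < 1"
  shows "qpochhammer u q = qpochhammer u (q\<^sup>2) * qpochhammer (u * q) (q\<^sup>2)"
proof -
  have q2: "norm (q\<^sup>2) < 1" using assms by (rule norm_power_less_1) simp
  have *: "(\<Prod>n<2 * N. 1 - u * q ^ n)
      = (\<Prod>n<N. 1 - u * (q\<^sup>2) ^ n) * (\<Prod>n<N. 1 - u * q * (q\<^sup>2) ^ n)" for N
    by (induction N) (simp_all add: power_mult[symmetric] mult_ac)
  \<comment> \<open>Partial products of even length split into equally many factors of each parity;
    passing to this subsequence keeps the limit.\<close>
  have "(\<lambda>N. \<Prod>n<2 * N. 1 - u * q ^ n) \<longlonglongrightarrow> qpochhammer u q"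
    using filterlim_compose[OF qpochhammer_LIMSEQ[OF assms], of "\<lambda>N. 2 * N"] mult_nat_left_at_top[of 2]
    by simp
  moreover have "(\<lambda>N. \<Prod>n<2 * N. 1 - u * q ^ n) \<longlonglongrightarrow> qpochhammer u (q\<^sup>2) * qpochhammer (u * q) (q\<^sup>2)"
    unfolding * by (intro tendsto_mult qpochhammer_LIMSEQ q2)
  ultimately show ?thesis by (rule LIMSEQ_unique)
qed

lemma qpochhammer_mult_minus:
  assumes "norm q < 1"
  shows "qpochhammer u q * qpochhammer (- u) q = qpochhammer (u\<^sup>2) (q\<^sup>2)"
proof -
  have q2: "norm (q\<^sup>2) < 1" using assms by (rule norm_power_less_1) simp
  have "(\<lambda>N. (\<Prod>n<N. 1 - u * q ^ n) * (\<Prod>n<N. 1 - (- u) * q ^ n)) \<longlonglongrightarrow> qpochhammer u q * qpochhammer (- u) q"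
    by (intro tendsto_mult qpochhammer_LIMSEQ assms)
  also have "(\<lambda>N. (\<Prod>n<N. 1 - u * q ^ n) * (\<Prod>n<N. 1 - (- u) * q ^ n))
      = (\<lambda>N. \<Prod>n<N. 1 - u\<^sup>2 * (q\<^sup>2) ^ n)"
    by (simp add: prod.distrib[symmetric] power_mult[symmetric] algebra_simps power2_eq_square power_mult_distrib)
  finally show ?thesis using qpochhammer_unique[OF q2] by simp
qed

section \<open>Fifth roots of unity and products over them\<close>

definition zeta5 :: complex where "zeta5 = exp (2 * of_real pi * \<i> / 5)"

lemma zeta_power_exp: "zeta5 ^ k = exp (2 * of_real pi * \<i> * of_nat k / 5)"
  unfolding zeta5_def by (subst exp_of_nat_mult[symmetric]) (simp add: field_simps)

lemma zeta_power_5: "zeta5 ^ 5 = 1"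
  using exp_two_pi_i by (simp add: zeta_power_exp mult_ac)

lemma zeta_sum: "1 + zeta5 + zeta5^2 + zeta5^3 + zeta5^4 = 0"
proof -
  have "zeta5 \<noteq> 1"
  proof
    assume "zeta5 = 1"
    then obtain n :: int where "Im (2 * of_real pi * \<i> / 5) = of_int (2 * n) * pi"
      unfolding zeta5_def exp_eq_1 by blast
    then have "of_int (2 * n) * pi = pi * (2 / 5)" by simp
    then have "real_of_int (5 * n) = real_of_int 1" by (simp add: field_simps)
    then show False by presburger
  qed
  moreover have "(1 - zeta5) * (1 + zeta5 + zeta5^2 + zeta5^3 + zeta5^4) = 1 - zeta5^5" by algebra
  ultimately show ?thesis by (simp add: zeta_power_5)
qed

text \<open>Factorisation of \<open>1 - X ^ 5\<close> over the fifth roots of unity; it follows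
  formally from \<open>zeta_sum\<close> and \<open>zeta_power_5\<close>.\<close>

lemma zeta_product:
  "(1 - zeta5 * X) * (1 - zeta5^2 * X) * (1 - zeta5^3 * X) * (1 - zeta5^4 * X) * (1 - X) = 1 - X ^ 5"
  using zeta_sum zeta_power_5 by algebra

lemma qpochhammer_zeta:
  assumes "norm q < 1"
  shows "qpochhammer (zeta5 * u) q * qpochhammer (zeta5^2 * u) q * qpochhammer (zeta5^3 * u) q * qpochhammer (zeta5^4 * u) q * qpochhammer u q
    = qpochhammer (u ^ 5) (q ^ 5)" (is "?l = _")
proof -
  have q5: "norm (q ^ 5) < 1" using assms by (rule norm_power_less_1) simp
  let ?P = "\<lambda>v N. \<Prod>n<N. 1 - v * q ^ n"
  have "(\<lambda>N. ?P (zeta5 * u) N * ?P (zeta5^2 * u) N * ?P (zeta5^3 * u) N * ?P (zeta5^4 * u) N * ?P u N) \<longlonglongrightarrow> ?l"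
    by (intro tendsto_mult qpochhammer_LIMSEQ assms)
  also have "(\<lambda>N. ?P (zeta5 * u) N * ?P (zeta5^2 * u) N * ?P (zeta5^3 * u) N * ?P (zeta5^4 * u) N * ?P u N)
      = (\<lambda>N. \<Prod>n<N. 1 - u ^ 5 * (q ^ 5) ^ n)"
    unfolding prod.distrib[symmetric] mult.assoc[of "zeta5 ^ _" u] mult.assoc[of "zeta5" u] zeta_product
    by (simp add: power_mult_distrib power_mult[symmetric] mult.commute)
  finally show ?thesis using qpochhammer_unique[OF q5] by simp
qed

text \<open>A locally uniform limit of polynomials in \<open>u\<close>: on a closed unit ball the
  perturbations of 1 are dominated by a geometric series.\<close>

lemma holomorphic_qpochhammer:
  assumes "norm q < 1"
  shows "(\<lambda>u. qpochhammer u q) holomorphic_on UNIV"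
proof (rule holomorphic_uniform_sequence[where f = "\<lambda>N u. \<Prod>n<N. 1 - u * q ^ n"])
  fix x :: complex
  have "uniformly_convergent_on (cball x 1) (\<lambda>N u. \<Prod>n<N. 1 + (- u * q ^ n))"
  proof (rule uniformly_convergent_on_prod)
    show "uniformly_convergent_on (cball x 1) (\<lambda>N u. \<Sum>n<N. norm (- u * q ^ n))"
    proof (rule uniformly_convergentI, rule Weierstrass_m_test)
      show "norm (norm (- u * q ^ n)) \<le> (norm x + 1) * norm q ^ n" if "u \<in> cball x 1" for n u
      proof -
        have "norm u \<le> norm x + 1"
          using that norm_triangle_ineq2[of u x] by (simp add: dist_norm norm_minus_commute)
        then show ?thesis by (simp add: norm_mult norm_power mult_right_mono)
      qed
      show "summable (\<lambda>n. (norm x + 1) * norm q ^ n)"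
        using assms by (intro summable_mult summable_geometric) auto
    qed
  qed (auto intro!: continuous_intros)
  then have "uniformly_convergent_on (cball x 1) (\<lambda>N u. \<Prod>n<N. 1 - u * q ^ n)" by simp
  then obtain l where l: "uniform_limit (cball x 1) (\<lambda>N u. \<Prod>n<N. 1 - u * q ^ n) l sequentially"
    by (auto simp: uniformly_convergent_on_def)
  moreover have "l u = qpochhammer u q" if "u \<in> cball x 1" for u
    using tendsto_uniform_limitI[OF l that] qpochhammer_unique[OF assms] by metis
  ultimately have "uniform_limit (cball x 1) (\<lambda>N u. \<Prod>n<N. 1 - u * q ^ n) (\<lambda>u. qpochhammer u q) sequentially"
    by (metis (mono_tags, lifting) uniform_limit_cong')
  then show "\<exists>d>0. cball x d \<subseteq> UNIV \<and>
      uniform_limit (cball x d) (\<lambda>N u. \<Prod>n<N. 1 - u * q ^ n) (\<lambda>u. qpochhammer u q) sequentially"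
    by (intro exI[of _ 1]) auto
qed (auto intro!: holomorphic_intros)

section \<open>The theta function\<close>

text \<open>The exponential factor makes \<open>theta \<tau>\<close> odd; in the classical notation this is
  $\theta_1(\pi w)$ up to a factor depending only on \<open>\<tau>\<close>.\<close>

definition theta :: "complex \<Rightarrow> complex \<Rightarrow> complex" where
  "theta \<tau> w = exp (- (of_real pi * \<i> * w)) * qpochhammer (q_of w) (q_of \<tau>) * qpochhammer (q_of (\<tau> - w)) (q_of \<tau>)"

lemma q_of_add: "q_of (a + b) = q_of a * q_of b"
  by (simp add: q_of_def ring_distribs exp_add)

lemma q_of_diff: "q_of (a - b) = q_of a / q_of b"
  by (simp add: q_of_def ring_distribs exp_diff)

lemma q_of_minus: "q_of (- a) = inverse (q_of a)"
  by (simp add: q_of_def exp_minus)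

lemma q_of_nonzero [simp]: "q_of w \<noteq> 0"
  by (simp add: q_of_def)

lemma q_of_int [simp]: "q_of (of_int n) = 1"
  unfolding q_of_def using exp_integer_2pi[of "of_int n"] by (simp add: mult_ac)

lemma q_of_0 [simp]: "q_of 0 = 1" and q_of_1 [simp]: "q_of 1 = 1"
  using q_of_int[of 0] q_of_int[of 1] by simp_all

lemma q_of_mult_nat: "q_of (of_nat n * w) = q_of w ^ n"
  by (simp add: q_of_def exp_of_nat_mult[symmetric] algebra_simps)

lemma q_of_numeral: "q_of (numeral n * w) = q_of w ^ numeral n"
  using q_of_mult_nat[of "numeral n" w] by simp

lemma q_of_half: "q_of (1 / 2) = - 1"
  by (simp add: q_of_def)

lemma q_of_eq_iff: "q_of v = q_of w \<longleftrightarrow> (\<exists>n::int. v = w + of_int n)"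
proof -
  have "q_of v = q_of w \<longleftrightarrow> (\<exists>n::int. 2 * of_real pi * \<i> * v = 2 * of_real pi * \<i> * w + of_int (2 * n) * pi * \<i>)"
    by (simp add: q_of_def exp_eq)
  also have "\<dots> \<longleftrightarrow> (\<exists>n::int. 2 * of_real pi * \<i> * v = 2 * of_real pi * \<i> * (w + of_int n))"
    by (simp add: algebra_simps)
  finally show ?thesis by simp
qed

lemma norm_q_of: "norm (q_of \<tau>) = exp (- 2 * pi * Im \<tau>)"
  by (simp add: q_of_def)

lemma norm_q_of_less_1 [simp]: "Im \<tau> > 0 \<Longrightarrow> norm (q_of \<tau>) < 1"
  by (simp add: norm_q_of)

lemma holomorphic_q_of [holomorphic_intros]: "f holomorphic_on S \<Longrightarrow> (\<lambda>w. q_of (f w)) holomorphic_on S"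
  unfolding q_of_def by (intro holomorphic_intros)

lemma holomorphic_theta:
  assumes "Im \<tau> > 0" "f holomorphic_on S"
  shows "(\<lambda>w. theta \<tau> (f w)) holomorphic_on S"
proof -
  have *: "(\<lambda>w. qpochhammer (g w) (q_of \<tau>)) holomorphic_on S" if "g holomorphic_on S" for g
    using holomorphic_on_compose[OF that holomorphic_on_subset[OF holomorphic_qpochhammer[of "q_of \<tau>"] subset_UNIV]] assms(1)
    by (simp add: o_def)
  show ?thesis unfolding theta_def
    by (intro holomorphic_intros * assms(2))
qed

text \<open>Splitting off the factors \<open>1 - q_of (- w)\<close> and \<open>1 - q_of w\<close>
  leaves the same pair of products for \<open>- w\<close> and \<open>w\<close>; the exponential
  prefactors make the two remaining terms opposite.\<close>

lemma theta_minus: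
  assumes "Im \<tau> > 0"
  shows "theta \<tau> (- w) = - theta \<tau> w"
proof -
  have q: "norm (q_of \<tau>) < 1" using assms by simp
  have "qpochhammer (q_of (- w)) (q_of \<tau>) = (1 - q_of (- w)) * qpochhammer (q_of (\<tau> - w)) (q_of \<tau>)"
    "qpochhammer (q_of w) (q_of \<tau>) = (1 - q_of w) * qpochhammer (q_of (\<tau> + w)) (q_of \<tau>)"
    using qpochhammer_Suc[OF q, of "q_of (- w)"] qpochhammer_Suc[OF q, of "q_of w"]
    by (simp_all add: q_of_add[symmetric] add.commute)
  moreover have "exp (of_real pi * \<i> * w) * (1 - q_of (- w)) = - (exp (- (of_real pi * \<i> * w)) * (1 - q_of w))"
    by (simp add: q_of_def algebra_simps flip: exp_add)
  ultimately show ?thesis unfolding theta_def by simp algebra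
qed

lemma exp_pi_i_1: "exp (- (of_real pi * \<i> * (w + 1))) = - exp (- (of_real pi * \<i> * w))"
  by (simp add: ring_distribs exp_diff mult.commute[of _ \<i>])

lemma theta_add_1: "theta \<tau> (w + 1) = - theta \<tau> w"
  by (simp add: theta_def q_of_add q_of_diff exp_pi_i_1)

text \<open>Translation by \<open>\<tau>\<close> removes the first factor of one product and adds a
  first factor to the other; their quotient is \<open>- inverse (q_of w)\<close>.\<close>

lemma theta_add_tau:
  assumes "Im \<tau> > 0"
  shows "theta \<tau> (w + \<tau>) = - exp (- (of_real pi * \<i> * \<tau>)) * inverse (q_of w) * theta \<tau> w"
proof -
  have q: "norm (q_of \<tau>) < 1" using assms by simp
  have "qpochhammer (q_of (- w)) (q_of \<tau>) = (1 - q_of (- w)) * qpochhammer (q_of (\<tau> - w)) (q_of \<tau>)"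
    "qpochhammer (q_of w) (q_of \<tau>) = (1 - q_of w) * qpochhammer (q_of (w + \<tau>)) (q_of \<tau>)"
    using qpochhammer_Suc[OF q, of "q_of (- w)"] qpochhammer_Suc[OF q, of "q_of w"]
    by (simp_all add: q_of_add[symmetric] add.commute)
  moreover have "1 - q_of (- w) = - inverse (q_of w) * (1 - q_of w)"
    by (simp add: q_of_minus field_simps)
  moreover have "exp (- (of_real pi * \<i> * (w + \<tau>))) = exp (- (of_real pi * \<i> * w)) * exp (- (of_real pi * \<i> * \<tau>))"
    by (simp add: ring_distribs flip: exp_add)
  ultimately show ?thesis unfolding theta_def by simp
qed

text \<open>The convergent products vanish only through a factor, which places zeros on the lattice.
  Conversely, quasi-periodicity carries the zero at 0 to all lattice points.\<close>

lemma theta_eq_0_iff: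
  assumes "Im \<tau> > 0"
  shows "theta \<tau> w = 0 \<longleftrightarrow> w \<in> lattice \<tau>"
proof
  have q: "norm (q_of \<tau>) < 1" using assms by simp
  assume "theta \<tau> w = 0"
  then obtain n :: nat where "q_of w * q_of \<tau> ^ n = 1 \<or> q_of (\<tau> - w) * q_of \<tau> ^ n = 1"
    using qpochhammer_eq_0_iff[OF q] by (auto simp: theta_def)
  then have "q_of (w + of_nat n * \<tau>) = q_of 0 \<or> q_of (\<tau> - w + of_nat n * \<tau>) = q_of 0"
    unfolding q_of_add q_of_mult_nat by simp
  then obtain m :: int where "w + of_nat n * \<tau> = of_int m \<or> \<tau> - w + of_nat n * \<tau> = of_int m"
    unfolding q_of_eq_iff by auto
  then have "w = of_int m + of_int (- int n) * \<tau> \<or> w = of_int (- m) + of_int (int n + 1) * \<tau>"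
    by (auto simp: algebra_simps)
  then show "w \<in> lattice \<tau>" using lattice_basis by metis
next
  assume w: "w \<in> lattice \<tau>"
  have 0: "theta \<tau> 0 = 0" using theta_minus[OF assms, of 0] by simp
  show "theta \<tau> w = 0"
  proof -
    obtain m n where w: "w = of_int m + of_int n * \<tau>" using w unfolding lattice_def by blast
    have z1: "theta \<tau> (v + 1) = 0 \<longleftrightarrow> theta \<tau> v = 0" for v by (simp add: theta_add_1)
    have zt: "theta \<tau> (v + \<tau>) = 0 \<longleftrightarrow> theta \<tau> v = 0" for v by (simp add: theta_add_tau[OF assms])
    have A: "theta \<tau> (of_int m) = 0" for m
    proof (induction m rule: int_induct[of _ 0])
      case (step2 i) then show ?case using z1[of "of_int i - 1"] by simp
    qed (use 0 z1 in simp_all)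
    have "theta \<tau> (of_int m + of_int n * \<tau>) = 0"
    proof (induction n rule: int_induct[of _ 0])
      case (step1 i) then show ?case using zt[of "of_int m + of_int i * \<tau>"] by (simp add: algebra_simps)
    next
      case (step2 i) then show ?case using zt[of "of_int m + (of_int i - 1) * \<tau>"] by (simp add: algebra_simps)
    qed (use A in simp)
    then show ?thesis by (simp add: w)
  qed
qed

lemma theta_deriv_0:
  assumes "Im \<tau> > 0"
  shows "(theta \<tau> has_field_derivative - 2 * of_real pi * \<i> * qpochhammer (q_of \<tau>) (q_of \<tau>) ^ 2) (at 0)"
proof -
  have q: "norm (q_of \<tau>) < 1" using assms by simp
  \<comment> \<open>The factor \<open>1 - q_of w\<close> isolates the simple zero at 0, so the
    derivative there is its derivative times \<open>g 0\<close>.\<close>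
  define g where "g = (\<lambda>w. exp (- (of_real pi * \<i> * w)) * qpochhammer (q_of (w + \<tau>)) (q_of \<tau>) * qpochhammer (q_of (\<tau> - w)) (q_of \<tau>))"
  have theta: "theta \<tau> = (\<lambda>w. (1 - q_of w) * g w)"
  proof
    fix w show "theta \<tau> w = (1 - q_of w) * g w"
      using qpochhammer_Suc[OF q, of "q_of w"] by (simp add: theta_def g_def q_of_add)
  qed
  have *: "(\<lambda>w. qpochhammer (g w) (q_of \<tau>)) holomorphic_on UNIV" if "g holomorphic_on UNIV" for g
    using holomorphic_on_compose[OF that holomorphic_on_subset[OF holomorphic_qpochhammer[OF q] subset_UNIV]]
    by (simp add: o_def)
  have "g holomorphic_on UNIV" unfolding g_def by (intro holomorphic_intros *)
  then have g: "(g has_field_derivative deriv g 0) (at 0)" by (auto intro!: holomorphic_derivI[of _ UNIV])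
  have "((\<lambda>w. 1 - q_of w) has_field_derivative - 2 * of_real pi * \<i>) (at 0)"
    unfolding q_of_def by (auto intro!: derivative_eq_intros)
  from DERIV_mult[OF this g] show ?thesis
    by (simp add: theta g_def power2_eq_square)
qed

text \<open>The second derivative of the logarithm of \<open>f\<close>, written without choosing a logarithm.\<close>

definition ddlog :: "(complex \<Rightarrow> complex) \<Rightarrow> complex \<Rightarrow> complex" where
  "ddlog f w = (deriv (deriv f) w * f w - (deriv f w)\<^sup>2) / (f w)\<^sup>2"

lemma entire_deriv:
  assumes "f holomorphic_on UNIV"
  shows "(f has_field_derivative deriv f w) (at w)"
    and "(deriv f has_field_derivative deriv (deriv f) w) (at w)"
  using assms holomorphic_deriv[OF assms] by (auto intro!: holomorphic_derivI[of _ UNIV])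

lemma ddlog_mult:
  assumes f: "f holomorphic_on UNIV" and g: "g holomorphic_on UNIV" and nz: "f w \<noteq> 0" "g w \<noteq> 0"
  shows "ddlog (\<lambda>w. f w * g w) w = ddlog f w + ddlog g w"
proof -
  have 1: "deriv (\<lambda>w. f w * g w) = (\<lambda>w. deriv f w * g w + deriv g w * f w)"
    using DERIV_mult[OF entire_deriv(1)[OF f] entire_deriv(1)[OF g]] DERIV_imp_deriv by blast
  have "((\<lambda>w. deriv f w * g w + deriv g w * f w) has_field_derivative
      (deriv (deriv f) w * g w + deriv g w * deriv f w) + (deriv (deriv g) w * f w + deriv f w * deriv g w)) (at w)"
    by (intro DERIV_add DERIV_mult entire_deriv f g)
  then have 2: "deriv (deriv (\<lambda>w. f w * g w)) w
      = (deriv (deriv f) w * g w + deriv g w * deriv f w) + (deriv (deriv g) w * f w + deriv f w * deriv g w)"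
    unfolding 1 by (rule DERIV_imp_deriv)
  show ?thesis unfolding ddlog_def 2 unfolding 1 using nz
    by (simp add: divide_simps) algebra
qed

text \<open>The multipliers of \<open>theta\<close> under its quasi-periods have this shape, so
  \<open>ddlog\<close> does not see them.\<close>

lemma ddlog_exp:
  assumes "c \<noteq> 0"
  shows "ddlog (\<lambda>w. c * exp (a * w)) w = 0"
proof -
  have *: "deriv (\<lambda>w. c * exp (a * w)) = (\<lambda>w. (c * a) * exp (a * w))" for c
  proof
    fix w show "deriv (\<lambda>w. c * exp (a * w)) w = (c * a) * exp (a * w)"
      by (rule DERIV_imp_deriv) (auto intro!: derivative_eq_intros)
  qed
  show ?thesis unfolding ddlog_def * by (simp add: power2_eq_square)
qed

lemma ddlog_compose:
  assumes f: "f holomorphic_on UNIV"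
  shows "ddlog (\<lambda>w. f (a * w + b)) w = a\<^sup>2 * ddlog f (a * w + b)"
proof -
  have *: "deriv (\<lambda>w. c * f (a * w + b)) = (\<lambda>w. (c * a) * deriv f (a * w + b))"
    if f: "f holomorphic_on UNIV" for f c
  proof
    fix w
    have "((\<lambda>w. f (a * w + b)) has_field_derivative deriv f (a * w + b) * a) (at w)"
      by (rule DERIV_chain2[OF entire_deriv(1)[OF f]]) (auto intro!: derivative_eq_intros)
    from DERIV_cmult[OF this, of c] show "deriv (\<lambda>w. c * f (a * w + b)) w = (c * a) * deriv f (a * w + b)"
      by (simp add: DERIV_imp_deriv mult_ac)
  qed
  have 1: "deriv (\<lambda>w. f (a * w + b)) = (\<lambda>w. a * deriv f (a * w + b))"
    using *[OF f, of 1] by simp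
  have 2: "deriv (deriv (\<lambda>w. f (a * w + b))) = (\<lambda>w. a * a * deriv (deriv f) (a * w + b))"
    unfolding 1 by (rule *) (use holomorphic_deriv[OF f] in auto)
  show ?thesis unfolding ddlog_def 2 unfolding 1 by (simp add: power2_eq_square right_diff_distrib mult_ac)
qed

section \<open>The Weierstrass function and its transformation\<close>

text \<open>With this sign, \<open>wp\<close> is $-\wp$ up to an additive constant depending on \<open>\<tau>\<close>.\<close>

definition wp :: "complex \<Rightarrow> complex \<Rightarrow> complex" where
  "wp \<tau> = ddlog (theta \<tau>)"

lemma entire_theta: "Im \<tau> > 0 \<Longrightarrow> theta \<tau> holomorphic_on UNIV"
  using holomorphic_theta[of \<tau> "\<lambda>w. w" UNIV] by (simp add: holomorphic_on_ident)

text \<open>One statement covers the translations by 1 and by \<open>\<tau>\<close> (with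
  \<open>a = 1\<close>) and the reflection (with \<open>a = - 1\<close>).\<close>

lemma wp_transform:
  assumes \<tau>: "Im \<tau> > 0" and w: "w \<notin> lattice \<tau>" and c: "c \<noteq> 0"
    and eq: "\<And>w. theta \<tau> (a * w + b) = c * exp (s * w) * theta \<tau> w"
  shows "a\<^sup>2 * wp \<tau> (a * w + b) = wp \<tau> w"
proof -
  have "a\<^sup>2 * wp \<tau> (a * w + b) = ddlog (\<lambda>w. theta \<tau> (a * w + b)) w"
    unfolding wp_def by (rule ddlog_compose[OF entire_theta[OF \<tau>], symmetric])
  also have "\<dots> = ddlog (\<lambda>w. c * exp (s * w)) w + wp \<tau> w"
    unfolding eq wp_def using theta_eq_0_iff[OF \<tau>] w c
    by (intro ddlog_mult holomorphic_intros entire_theta \<tau>) auto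
  finally show ?thesis using ddlog_exp[OF c] by simp
qed

lemma wp_add_1: "Im \<tau> > 0 \<Longrightarrow> w \<notin> lattice \<tau> \<Longrightarrow> wp \<tau> (w + 1) = wp \<tau> w"
  using wp_transform[of \<tau> w "-1" 1 1 0] by (simp add: theta_add_1)

lemma wp_minus: "Im \<tau> > 0 \<Longrightarrow> w \<notin> lattice \<tau> \<Longrightarrow> wp \<tau> (- w) = wp \<tau> w"
  using wp_transform[of \<tau> w "-1" "-1" 0 0] by (simp add: theta_minus)

lemma wp_add_tau: "Im \<tau> > 0 \<Longrightarrow> w \<notin> lattice \<tau> \<Longrightarrow> wp \<tau> (w + \<tau>) = wp \<tau> w"
  using wp_transform[of \<tau> w "- exp (- (of_real pi * \<i> * \<tau>))" 1 \<tau> "- (2 * of_real pi * \<i>)"]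
  by (simp add: theta_add_tau q_of_def exp_minus[of "2 * of_real pi * \<i> * _"])

lemma wp_add_lattice: "Im \<tau> > 0 \<Longrightarrow> w \<notin> lattice \<tau> \<Longrightarrow> l \<in> lattice \<tau> \<Longrightarrow> wp \<tau> (w + l) = wp \<tau> w"
  by (rule lattice_periodic[of \<tau> "wp \<tau>" l w]) (simp_all add: wp_add_1 wp_add_tau)

lemma holomorphic_wp:
  assumes \<tau>: "Im \<tau> > 0"
  shows "wp \<tau> holomorphic_on - lattice \<tau>"
proof -
  have [holomorphic_intros]: "theta \<tau> holomorphic_on - lattice \<tau>"
    "deriv (theta \<tau>) holomorphic_on - lattice \<tau>" "deriv (deriv (theta \<tau>)) holomorphic_on - lattice \<tau>"
    using entire_theta[OF \<tau>] holomorphic_deriv[OF entire_theta[OF \<tau>]]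
      holomorphic_deriv[OF holomorphic_deriv[OF entire_theta[OF \<tau>]]] holomorphic_on_subset[OF _ subset_UNIV] by auto
  show ?thesis unfolding wp_def ddlog_def[abs_def]
    by (intro holomorphic_intros) (use theta_eq_0_iff[OF \<tau>] in auto)
qed

text \<open>The derivative of \<open>theta \<tau>\<close> at 0.\<close>

definition dtheta0 :: "complex \<Rightarrow> complex" where
  "dtheta0 \<tau> = - 2 * of_real pi * \<i> * qpochhammer (q_of \<tau>) (q_of \<tau>) ^ 2"

lemma theta_over_limit:
  assumes \<tau>: "Im \<tau> > 0"
  shows "((\<lambda>w. theta \<tau> w / w) \<longlongrightarrow> dtheta0 \<tau>) (at 0)"
  using theta_deriv_0[OF \<tau>] theta_eq_0_iff[OF \<tau>, of 0] by (simp add: has_field_derivative_iff dtheta0_def)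

lemma dtheta0_nonzero: "Im \<tau> > 0 \<Longrightarrow> dtheta0 \<tau> \<noteq> 0"
  using qpochhammer_self_nonzero[of "q_of \<tau>"] by (simp add: dtheta0_def)

text \<open>Since \<open>theta\<close> has a simple zero at 0, the second derivative of its
  logarithm behaves like that of log w, namely like -1/w^2.\<close>

lemma wp_limit:
  assumes \<tau>: "Im \<tau> > 0"
  shows "((\<lambda>w. w\<^sup>2 * wp \<tau> w) \<longlongrightarrow> - 1) (at 0)"
proof -
  have c: "(f \<longlongrightarrow> f 0) (at 0)" if "f holomorphic_on UNIV" for f :: "complex \<Rightarrow> complex"
    using holomorphic_on_imp_continuous_on[OF that] by (simp add: continuous_on_def)
  note h = entire_theta[OF \<tau>]
  have [tendsto_intros]: "(theta \<tau> \<longlongrightarrow> 0) (at 0)" "(deriv (theta \<tau>) \<longlongrightarrow> dtheta0 \<tau>) (at 0)"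
    "(deriv (deriv (theta \<tau>)) \<longlongrightarrow> deriv (deriv (theta \<tau>)) 0) (at 0)"
    using c[OF h] c[of "deriv (theta \<tau>)"] c[of "deriv (deriv (theta \<tau>))"] holomorphic_deriv[OF h]
      theta_eq_0_iff[OF \<tau>, of 0] DERIV_imp_deriv[OF theta_deriv_0[OF \<tau>]] dtheta0_def[of \<tau>] holomorphic_deriv[of "deriv (theta \<tau>)" UNIV]
    by simp_all
  have "((\<lambda>w. (deriv (deriv (theta \<tau>)) w * theta \<tau> w - (deriv (theta \<tau>) w)\<^sup>2) / (theta \<tau> w / w)\<^sup>2) \<longlongrightarrow>
      (deriv (deriv (theta \<tau>)) 0 * 0 - (dtheta0 \<tau>)\<^sup>2) / (dtheta0 \<tau>)\<^sup>2) (at 0)"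
    by (intro tendsto_intros theta_over_limit \<tau>) (use dtheta0_nonzero[OF \<tau>] in simp)
  also have "(deriv (deriv (theta \<tau>)) 0 * 0 - (dtheta0 \<tau>)\<^sup>2) / (dtheta0 \<tau>)\<^sup>2 = - 1"
    using dtheta0_nonzero[OF \<tau>] by simp
  finally show ?thesis
    by (rule Lim_transform_eventually)
       (auto simp: eventually_at_filter wp_def ddlog_def power_divide)
qed

text \<open>For fixed \<open>v\<close>, both sides are even and elliptic in \<open>w\<close>: the
  multipliers of theta(w + v) theta(w - v) and of theta(w)^2 agree. Their double poles at 0 also
  agree, and the remaining constant is found at w = v, where theta(w - v) vanishes.\<close>

lemma wp_diff:
  assumes \<tau>: "Im \<tau> > 0" and w: "w \<notin> lattice \<tau>" and v: "v \<notin> lattice \<tau>"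
  shows "wp \<tau> w - wp \<tau> v = (dtheta0 \<tau>)\<^sup>2 * theta \<tau> (w + v) * theta \<tau> (w - v) / ((theta \<tau> w)\<^sup>2 * (theta \<tau> v)\<^sup>2)"
proof -
  define N where "N = (\<lambda>w. (dtheta0 \<tau>)\<^sup>2 / (theta \<tau> v)\<^sup>2 * (theta \<tau> (w + v) * theta \<tau> (w - v)))"
  define f where "f = (\<lambda>w. wp \<tau> w - N w / (theta \<tau> w)\<^sup>2)"
  have nz: "theta \<tau> w \<noteq> 0" if "w \<notin> lattice \<tau>" for w using theta_eq_0_iff[OF \<tau>] that by blast
  have N_hol: "N holomorphic_on UNIV" unfolding N_def
    by (intro holomorphic_intros holomorphic_theta \<tau>)
  obtain K where K: "\<And>w. w \<notin> lattice \<tau> \<Longrightarrow> f w = K"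
  proof (rule even_elliptic_constant[OF \<tau>, of f])
    show "f holomorphic_on - lattice \<tau>" unfolding f_def
      by (intro holomorphic_intros holomorphic_wp holomorphic_theta \<tau> holomorphic_on_subset[OF N_hol]) (use nz in auto)
    have 1: "N (w + 1) = N w" for w
      using theta_add_1[of \<tau> "w + v"] theta_add_1[of \<tau> "w - v"] by (simp add: N_def algebra_simps)
    show "f (w + 1) = f w" if "w \<notin> lattice \<tau>" for w
      using that by (simp add: f_def wp_add_1 \<tau> 1 theta_add_1)
    have 2: "N (w + \<tau>) = (- exp (- (of_real pi * \<i> * \<tau>)) * inverse (q_of w))\<^sup>2 * N w" for w
    proof -
      have *: "w + \<tau> + v = (w + v) + \<tau>" "w + \<tau> - v = (w - v) + \<tau>" by simp_all
      show ?thesis unfolding N_def * theta_add_tau[OF \<tau>]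
        by (simp add: q_of_add q_of_diff power2_eq_square field_simps)
    qed
    show "f (w + \<tau>) = f w" if "w \<notin> lattice \<tau>" for w
      using that by (simp add: f_def wp_add_tau \<tau> 2 theta_add_tau power_mult_distrib)
    have 3: "N (- w) = N w" for w
      using theta_minus[OF \<tau>, of "w + v"] theta_minus[OF \<tau>, of "w - v"] by (simp add: N_def)
    show "f (- w) = f w" if "w \<notin> lattice \<tau>" for w
      using that by (simp add: f_def wp_minus \<tau> 3 theta_minus)
    have "(N \<longlongrightarrow> N 0) (at 0)"
      using holomorphic_on_imp_continuous_on[OF N_hol] by (simp add: continuous_on_def)
    then have "((\<lambda>w. w\<^sup>2 * wp \<tau> w - N w / (theta \<tau> w / w)\<^sup>2) \<longlongrightarrow> - 1 - N 0 / (dtheta0 \<tau>)\<^sup>2) (at 0)"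
      using dtheta0_nonzero[OF \<tau>] by (intro tendsto_intros theta_over_limit wp_limit \<tau>) simp_all
    also have "- 1 - N 0 / (dtheta0 \<tau>)\<^sup>2 = 0"
      using dtheta0_nonzero[OF \<tau>] nz[OF v] by (simp add: N_def theta_minus[OF \<tau>] power2_eq_square)
    finally show "((\<lambda>w. w\<^sup>2 * f w) \<longlongrightarrow> 0) (at 0)"
      by (rule Lim_transform_eventually)
         (auto simp: eventually_at_filter f_def power_divide right_diff_distrib)
  qed blast
  have "N v = 0" using theta_eq_0_iff[OF \<tau>, of 0] by (simp add: N_def)
  then have "K = wp \<tau> v" using K[OF v] by (simp add: f_def)
  then have "wp \<tau> w - wp \<tau> v = N w / (theta \<tau> w)\<^sup>2" using K[OF w] by (simp add: f_def algebra_simps)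
  then show ?thesis by (simp add: N_def mult_ac)
qed

section \<open>Change of lattice basis by integer matrices of determinant one\<close>

lemma Im_moebius:
  assumes \<tau>: "Im \<tau> > 0" and det: "a * d - b * c = (1::int)"
    and j: "j = of_int c * \<tau> + of_int d" and \<gamma>: "\<gamma> = (of_int a * \<tau> + of_int b) / j"
  shows "j \<noteq> 0" "Im \<gamma> > 0"
proof -
  show j0: "j \<noteq> 0"
  proof
    assume "j = 0"
    then have "Im j = 0" "Re j = 0" by simp_all
    then have "c = 0" "d = 0" using \<tau> by (auto simp: j)
    then show False using det by simp
  qed
  have "\<gamma> = (of_int a * \<tau> + of_int b) * cnj j / of_real ((norm j)\<^sup>2)"
    using j0 unfolding \<gamma> complex_norm_square by (simp add: divide_simps)
  then have "Im \<gamma> = Im ((of_int a * \<tau> + of_int b) * cnj j) / (norm j)\<^sup>2"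
    by (simp only: Im_divide_of_real)
  also have "Im ((of_int a * \<tau> + of_int b) * cnj j) = of_int (a * d - b * c) * Im \<tau>"
    by (simp add: j algebra_simps)
  finally show "Im \<gamma> > 0" using \<tau> j0 det by simp
qed

text \<open>The numbers \<open>j\<close> and \<open>of_int a * \<tau> + of_int b\<close> form
  another basis of \<open>lattice \<tau>\<close>; division by \<open>j\<close> turns them into 1 and
  \<open>\<gamma>\<close>.\<close>

lemma lattice_moebius:
  assumes det: "a * d - b * c = (1::int)" and j0: "j \<noteq> 0"
    and j: "j = of_int c * \<tau> + of_int d" and \<gamma>: "\<gamma> = (of_int a * \<tau> + of_int b) / j"
  shows "w / j \<in> lattice \<gamma> \<longleftrightarrow> w \<in> lattice \<tau>"
proof
  assume "w / j \<in> lattice \<gamma>"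
  then obtain m n where "w / j = of_int m + of_int n * \<gamma>" unfolding lattice_def by blast
  then have "w = of_int m * j + of_int n * (of_int a * \<tau> + of_int b)"
    using j0 by (simp add: \<gamma> field_simps)
  then have "w = of_int (m * d + n * b) + of_int (m * c + n * a) * \<tau>"
    by (simp add: j algebra_simps)
  then show "w \<in> lattice \<tau>" by (simp only: lattice_basis)
next
  assume "w \<in> lattice \<tau>"
  then obtain m n where w: "w = of_int m + of_int n * \<tau>" unfolding lattice_def by blast
  \<comment> \<open>The coefficients come from inverting the unimodular change of basis.\<close>
  have "of_int (m * a - n * b) * j + of_int (n * d - m * c) * (of_int a * \<tau> + of_int b)
      = of_int (a * d - b * c) * w" by (simp add: j w algebra_simps)
  then have "w / j = of_int (m * a - n * b) + of_int (n * d - m * c) * \<gamma>"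
    using j0 det by (simp add: \<gamma> field_simps)
  then show "w / j \<in> lattice \<gamma>" by (simp only: lattice_basis)
qed

text \<open>The rescaled function has the periods 1 and \<open>\<tau>\<close> and the same
  coefficient at its double pole as \<open>wp \<tau>\<close>. A constant remains because defining
  \<open>wp\<close> through \<open>theta\<close> fixes its additive normalisation differently for
  each basis.\<close>

lemma wp_moebius:
  assumes \<tau>: "Im \<tau> > 0" and det: "a * d - b * c = (1::int)"
    and j: "j = of_int c * \<tau> + of_int d" and \<gamma>: "\<gamma> = (of_int a * \<tau> + of_int b) / j"
  obtains K where "\<And>w. w \<notin> lattice \<tau> \<Longrightarrow> wp \<gamma> (w / j) / j\<^sup>2 - wp \<tau> w = K"
proof (rule even_elliptic_constant[OF \<tau>, of "\<lambda>w. wp \<gamma> (w / j) / j\<^sup>2 - wp \<tau> w"])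
  note j0 = Im_moebius(1)[OF assms] and g = Im_moebius(2)[OF assms]
  note lattice = lattice_moebius[OF det j0 j \<gamma>]
  have "(\<lambda>w. wp \<gamma> (w / j)) holomorphic_on - lattice \<tau>"
    by (rule holomorphic_on_compose_gen[OF _ holomorphic_wp[OF g], unfolded o_def])
       (use lattice j0 in \<open>auto intro!: holomorphic_intros\<close>)
  then show "(\<lambda>w. wp \<gamma> (w / j) / j\<^sup>2 - wp \<tau> w) holomorphic_on - lattice \<tau>"
    by (intro holomorphic_intros holomorphic_wp \<tau>) (use j0 in auto)
  have per: "wp \<gamma> ((w + l) / j) = wp \<gamma> (w / j)" if "w \<notin> lattice \<tau>" "l \<in> lattice \<tau>" for w l
    using wp_add_lattice[OF g, of "w / j" "l / j"] that lattice by (simp add: add_divide_distrib)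
  show "wp \<gamma> ((w + 1) / j) / j\<^sup>2 - wp \<tau> (w + 1) = wp \<gamma> (w / j) / j\<^sup>2 - wp \<tau> w" if "w \<notin> lattice \<tau>" for w
    using that by (simp add: per wp_add_1 \<tau>)
  show "wp \<gamma> ((w + \<tau>) / j) / j\<^sup>2 - wp \<tau> (w + \<tau>) = wp \<gamma> (w / j) / j\<^sup>2 - wp \<tau> w" if "w \<notin> lattice \<tau>" for w
    using that by (simp add: per wp_add_tau \<tau>)
  show "wp \<gamma> (- w / j) / j\<^sup>2 - wp \<tau> (- w) = wp \<gamma> (w / j) / j\<^sup>2 - wp \<tau> w" if "w \<notin> lattice \<tau>" for w
    using that wp_minus[OF g, of "w / j"] lattice by (simp add: wp_minus \<tau>)
  have "filterlim (\<lambda>w. w / j) (at 0) (at 0)"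
    using j0 by (auto simp: filterlim_at eventually_at_filter intro!: tendsto_eq_intros)
  from filterlim_compose[OF wp_limit[OF g] this]
  have "((\<lambda>w. (w / j)\<^sup>2 * wp \<gamma> (w / j) - w\<^sup>2 * wp \<tau> w) \<longlongrightarrow> - 1 - (- 1)) (at 0)"
    by (intro tendsto_diff wp_limit \<tau>)
  then show "((\<lambda>w. w\<^sup>2 * (wp \<gamma> (w / j) / j\<^sup>2 - wp \<tau> w)) \<longlongrightarrow> 0) (at 0)"
    by (simp add: power_divide right_diff_distrib)
qed (use that in blast)

text \<open>The difference of two values removes the additive constant of
  \<open>wp_moebius\<close>.\<close>

definition wp5 :: "complex \<Rightarrow> complex" where
  "wp5 \<tau> = wp \<tau> (1 / 5) - wp \<tau> (2 / 5)"

lemma of_real_in_lattice: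
  assumes "Im \<tau> > 0"
  shows "of_real x \<in> lattice \<tau> \<longleftrightarrow> x \<in> \<int>"
proof
  assume "of_real x \<in> lattice \<tau>"
  then obtain m n where x: "complex_of_real x = of_int m + of_int n * \<tau>" unfolding lattice_def by blast
  from arg_cong[OF x, of Im] have "n = 0" using assms by simp
  with x have "complex_of_real x = complex_of_real (of_int m)" by simp
  then show "x \<in> \<int>" unfolding of_real_eq_iff by simp
next
  assume "x \<in> \<int>"
  then obtain m where "x = of_int m" by (rule Ints_cases)
  then show "of_real x \<in> lattice \<tau>" using lattice_basis[of m 0 \<tau>] by simp
qed

lemma fifth_notin_lattice:
  assumes "Im \<tau> > 0" "\<not> 5 dvd (k::int)"
  shows "of_int k / 5 \<notin> lattice \<tau>"
proof
  assume "of_int k / 5 \<in> lattice \<tau>"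
  then have "real_of_int k / 5 \<in> \<int>" using of_real_in_lattice[OF assms(1), of "of_int k / 5"] by simp
  then obtain m :: int where "real_of_int k / 5 = of_int m" by (rule Ints_cases)
  then have "real_of_int k = real_of_int (5 * m)" by simp
  then have "k = 5 * m" by linarith
  then show False using assms(2) by simp
qed

lemma wp_fifth:
  assumes \<tau>: "Im \<tau> > 0" and l: "\<not> 5 dvd (l::int)" and k: "k = l + 5 * m \<or> k = - l + 5 * m"
  shows "wp \<tau> (of_int k / 5) = wp \<tau> (of_int l / 5)"
proof -
  have *: "wp \<tau> (of_int l / 5 + of_int m) = wp \<tau> (of_int l / 5)" if "\<not> 5 dvd l" for l
    using wp_add_lattice[OF \<tau> fifth_notin_lattice[OF \<tau> that] lattice_basis[of m 0 \<tau>]] by simp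
  have "complex_of_int k / 5 = of_int l / 5 + of_int m \<or> complex_of_int k / 5 = of_int (- l) / 5 + of_int m"
  proof -
    have "complex_of_int k = of_int (l + 5 * m) \<or> complex_of_int k = of_int (- l + 5 * m)"
      using k by blast
    then show ?thesis by (simp add: field_simps)
  qed
  then show ?thesis
    using *[of l] *[of "- l"] l wp_minus[OF \<tau> fifth_notin_lattice[OF \<tau> l]]
    by (auto simp: add_divide_distrib diff_divide_distrib)
qed

text \<open>Multiplication by \<open>d\<close> permutes the nonzero classes modulo 5. Up to sign, it
  fixes or exchanges the classes of 1 and 2, which produces the quadratic character of
  \<open>d\<close> modulo 5.\<close>

lemma wp5_moebius:
  assumes \<tau>: "Im \<tau> > 0" and det: "a * d - b * (5 * c) = (1::int)"
    and j: "j = of_int (5 * c) * \<tau> + of_int d" and \<gamma>: "\<gamma> = (of_int a * \<tau> + of_int b) / j"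
  shows "wp5 \<gamma> = j\<^sup>2 * (wp \<tau> (of_int d / 5) - wp \<tau> (of_int (2 * d) / 5))"
proof -
  obtain K where K: "\<And>w. w \<notin> lattice \<tau> \<Longrightarrow> wp \<gamma> (w / j) / j\<^sup>2 - wp \<tau> w = K"
    using wp_moebius[OF assms] by blast
  note j0 = Im_moebius(1)[OF assms] and g = Im_moebius(2)[OF assms]
  note lattice = lattice_moebius[OF det j0 j \<gamma>]
  have d: "\<not> 5 dvd d"
  proof
    assume "5 dvd d"
    then have "5 dvd a * d - b * (5 * c)" by simp
    then show False by (simp add: det)
  qed
  \<comment> \<open>The relation with \<open>K\<close> is used at \<open>of_int k * j / 5\<close>.
    As the lower left entry is divisible by 5, this point differs from
    \<open>of_int (k * d) / 5\<close> by a lattice point.\<close>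
  have *: "wp \<gamma> (of_int k / 5) = j\<^sup>2 * (K + wp \<tau> (of_int (k * d) / 5))" if "\<not> 5 dvd k" for k
  proof -
    have "of_int k * j / 5 \<notin> lattice \<tau>"
      using fifth_notin_lattice[OF g that] lattice[of "of_int k * j / 5"] j0 by simp
    from K[OF this] have "wp \<gamma> (of_int k / 5) = j\<^sup>2 * (K + wp \<tau> (of_int k * j / 5))"
      using j0 by (simp add: field_simps)
    also have "of_int k * j / 5 = of_int (k * d) / 5 + (of_int 0 + of_int (k * c) * \<tau>)"
      by (simp add: j field_simps)
    also have "wp \<tau> \<dots> = wp \<tau> (of_int (k * d) / 5)"
    proof (rule wp_add_lattice[OF \<tau> fifth_notin_lattice[OF \<tau>] lattice_basis])
      have "prime (5::int)" by simp
      with that d show "\<not> 5 dvd k * d" using prime_dvd_mult_iff by blast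
    qed
    finally show ?thesis .
  qed
  have "wp \<gamma> (1 / 5) = j\<^sup>2 * (K + wp \<tau> (of_int d / 5))" "wp \<gamma> (2 / 5) = j\<^sup>2 * (K + wp \<tau> (of_int (2 * d) / 5))"
    using *[of 1] *[of 2] by simp_all
  then show ?thesis unfolding wp5_def by (simp only: right_diff_distrib distrib_left) simp
qed

text \<open>The argument is \<open>4 * W \<tau>\<close>, with \<open>d = - 6\<close> congruent to -1
  modulo 5. The next two lemmas serve \<open>2 * W \<tau>\<close> and \<open>W \<tau>\<close>, and
  are later applied at \<open>2 * \<tau>\<close> and \<open>4 * \<tau>\<close>.\<close>

lemma wp5_4W:
  assumes "Im \<tau> > 0"
  shows "wp5 ((4 * \<tau> - 1) / (25 * \<tau> - 6)) = (25 * \<tau> - 6)\<^sup>2 * wp5 \<tau>"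
proof -
  have "wp \<tau> (of_int (- 6) / 5) = wp \<tau> (1 / 5)" "wp \<tau> (of_int (2 * - 6) / 5) = wp \<tau> (2 / 5)"
    using wp_fifth[of \<tau> 1 "- 6" "- 1"] wp_fifth[of \<tau> 2 "2 * - 6" "- 2"] assms by simp_all
  moreover have "wp5 ((4 * \<tau> - 1) / (25 * \<tau> - 6)) =
      (25 * \<tau> - 6)\<^sup>2 * (wp \<tau> (of_int (- 6) / 5) - wp \<tau> (of_int (2 * - 6) / 5))"
    by (rule wp5_moebius[of \<tau> 4 "- 6" "- 1" 5]) (use assms in simp_all)
  ultimately show ?thesis by (simp only: wp5_def)
qed

text \<open>The minus sign arises because \<open>d = - 12\<close> is a quadratic nonresidue modulo
  5, so the values at 1/5 and 2/5 are exchanged.\<close>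

lemma wp5_2W:
  assumes "Im \<tau> > 0"
  shows "wp5 ((2 * \<tau> - 1) / (25 * \<tau> - 12)) = - ((25 * \<tau> - 12)\<^sup>2 * wp5 \<tau>)"
proof -
  have "wp \<tau> (of_int (- 12) / 5) = wp \<tau> (2 / 5)" "wp \<tau> (of_int (2 * - 12) / 5) = wp \<tau> (1 / 5)"
    using wp_fifth[of \<tau> 2 "- 12" "- 2"] wp_fifth[of \<tau> 1 "2 * - 12" "- 5"] assms by simp_all
  moreover have "wp5 ((2 * \<tau> - 1) / (25 * \<tau> - 12)) =
      (25 * \<tau> - 12)\<^sup>2 * (wp \<tau> (of_int (- 12) / 5) - wp \<tau> (of_int (2 * - 12) / 5))"
    by (rule wp5_moebius[of \<tau> 2 "- 12" "- 1" 5]) (use assms in simp_all)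
  ultimately show ?thesis by (simp only: wp5_def right_diff_distrib minus_diff_eq)
qed

lemma wp5_W:
  assumes "Im \<tau> > 0"
  shows "wp5 ((\<tau> - 1) / (25 * \<tau> - 24)) = (25 * \<tau> - 24)\<^sup>2 * wp5 \<tau>"
proof -
  have "wp \<tau> (of_int (- 24) / 5) = wp \<tau> (1 / 5)" "wp \<tau> (of_int (2 * - 24) / 5) = wp \<tau> (2 / 5)"
    using wp_fifth[of \<tau> 1 "- 24" "- 5"] wp_fifth[of \<tau> 2 "2 * - 24" "- 10"] assms by simp_all
  moreover have "wp5 ((\<tau> - 1) / (25 * \<tau> - 24)) =
      (25 * \<tau> - 24)\<^sup>2 * (wp \<tau> (of_int (- 24) / 5) - wp \<tau> (of_int (2 * - 24) / 5))"
    by (rule wp5_moebius[of \<tau> 1 "- 24" "- 1" 5]) (use assms in simp_all)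
  ultimately show ?thesis by (simp only: wp5_def)
qed

section \<open>Division values of order five as eta quotients\<close>

definition euler_prod :: "complex \<Rightarrow> complex" where
  "euler_prod q = qpochhammer q q"

text \<open>This is $\eta(\tau)^5/\eta(5\tau)$: the fractional powers of \<open>q\<close> cancel.\<close>

definition eta5_quot :: "complex \<Rightarrow> complex" where
  "eta5_quot \<tau> = euler_prod (q_of \<tau>) ^ 5 / euler_prod (q_of \<tau> ^ 5)"

lemma euler_prod_nonzero: "norm q < 1 \<Longrightarrow> euler_prod q \<noteq> 0"
  by (simp add: euler_prod_def qpochhammer_self_nonzero)

lemma eta5_quot_nonzero: "Im \<tau> > 0 \<Longrightarrow> eta5_quot \<tau> \<noteq> 0"
  by (simp add: eta5_quot_def euler_prod_nonzero norm_power_less_1)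

lemma q_of_fifth: "q_of (1 / 5) = zeta5" "q_of (2 / 5) = zeta5\<^sup>2"
  unfolding zeta_power_exp[of 2] by (simp_all add: q_of_def zeta5_def mult_ac)

lemma inverse_zeta: "inverse zeta5 = zeta5 ^ 4" "inverse (zeta5\<^sup>2) = zeta5 ^ 3"
proof -
  have "zeta5 * zeta5 ^ 4 = 1" "zeta5\<^sup>2 * zeta5 ^ 3 = 1" using zeta_power_5 by algebra+
  then show "inverse zeta5 = zeta5 ^ 4" "inverse (zeta5\<^sup>2) = zeta5 ^ 3" by (auto intro: inverse_unique)
qed

lemma q_of_diff_fifth: "q_of (a - 1 / 5) = zeta5 ^ 4 * q_of a" "q_of (a - 2 / 5) = zeta5 ^ 3 * q_of a"
  unfolding q_of_diff q_of_fifth unfolding divide_inverse inverse_zeta by (rule mult.commute)+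

text \<open>The product of the exponential prefactors of \<open>theta\<close> at 1/5 and
  2/5.\<close>

definition eps5 :: complex where "eps5 = exp (- (of_real pi * \<i> * (3 / 5)))"

lemma epsilon_square: "eps5\<^sup>2 = zeta5\<^sup>2"
proof -
  have "eps5\<^sup>2 * zeta5 ^ 3 = exp (- (2 * (of_real pi * \<i> * (3 / 5))) + 2 * of_real pi * \<i> * of_nat 3 / 5)"
    unfolding eps5_def zeta_power_exp exp_add exp_double[symmetric] by (simp add: exp_double mult_minus_right[symmetric])
  also have "\<dots> = exp 0" by (rule arg_cong[of _ _ exp]) simp
  finally have "eps5\<^sup>2 * zeta5 ^ 3 = 1" by simp
  moreover have "eps5\<^sup>2 * zeta5 ^ 5 = (eps5\<^sup>2 * zeta5 ^ 3) * zeta5\<^sup>2"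
    by (simp add: eval_nat_numeral mult_ac)
  ultimately show ?thesis by (simp add: zeta_power_5)
qed

lemma exp_fifths: "exp (- (of_real pi * \<i> * (1 / 5 + a))) * exp (- (of_real pi * \<i> * (2 / 5 + a)))
    = eps5 * inverse (q_of a)"
proof -
  have "- (of_real pi * \<i> * (1 / 5 + a)) + - (of_real pi * \<i> * (2 / 5 + a))
      = - (of_real pi * \<i> * (3 / 5)) + - (2 * of_real pi * \<i> * a)"
    by (simp add: algebra_simps)
  then show ?thesis by (simp only: eps5_def q_of_def exp_minus[symmetric] exp_add[symmetric])
qed

text \<open>A square root of 5, collecting what \<open>theta_fifths\<close> leaves besides infinite
  products; its sign is never determined.\<close>

definition fifth_const :: complex where "fifth_const = eps5 * (1 - zeta5) * (1 - zeta5\<^sup>2)"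

lemma fifth_const_square: "fifth_const\<^sup>2 = 5"
proof -
  have "fifth_const\<^sup>2 = zeta5\<^sup>2 * ((1 - zeta5) * (1 - zeta5\<^sup>2))\<^sup>2"
    unfolding fifth_const_def power_mult_distrib epsilon_square by (simp add: mult_ac)
  also have "\<dots> = 5" using zeta_sum zeta_power_5 by algebra
  finally show ?thesis .
qed

lemma fifth_const_nonzero: "fifth_const \<noteq> 0" using fifth_const_square by auto

text \<open>The four products run over the four primitive fifth roots of unity once the factors
  \<open>1 - zeta5\<close> and \<open>1 - zeta5\<^sup>2\<close> are split off. Multiplication by
  \<open>euler_prod\<close> supplies the missing root 1, and \<open>qpochhammer_zeta\<close>
  applies.\<close>

lemma theta_fifths:
  assumes \<tau>: "Im \<tau> > 0"
  shows "theta \<tau> (1 / 5) * theta \<tau> (2 / 5) * euler_prod (q_of \<tau>) = fifth_const * euler_prod (q_of \<tau> ^ 5)"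
proof -
  let ?q = "q_of \<tau>"
  have q: "norm ?q < 1" using \<tau> by simp
  have *: "q_of (\<tau> - 1 / 5) = zeta5 ^ 4 * ?q" "q_of (\<tau> - 2 / 5) = zeta5 ^ 3 * ?q"
    by (rule q_of_diff_fifth)+
  have "theta \<tau> (1 / 5) * theta \<tau> (2 / 5) =
      (exp (- (of_real pi * \<i> * (1 / 5 + 0))) * exp (- (of_real pi * \<i> * (2 / 5 + 0)))) *
      (qpochhammer zeta5 ?q * qpochhammer (zeta5\<^sup>2) ?q * qpochhammer (zeta5 ^ 3 * ?q) ?q * qpochhammer (zeta5 ^ 4 * ?q) ?q)"
    unfolding theta_def * q_of_fifth by simp
  also have "\<dots> = fifth_const * (qpochhammer (zeta5 * ?q) ?q * qpochhammer (zeta5\<^sup>2 * ?q) ?q * qpochhammer (zeta5 ^ 3 * ?q) ?q * qpochhammer (zeta5 ^ 4 * ?q) ?q)"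
    unfolding exp_fifths fifth_const_def qpochhammer_Suc[OF q, of zeta5] qpochhammer_Suc[OF q, of "zeta5\<^sup>2"] by simp
  finally show ?thesis unfolding euler_prod_def using qpochhammer_zeta[OF q, of ?q] by (simp add: mult.assoc)
qed

text \<open>The analogue at points shifted by the half period \<open>\<tau>\<close> of the lattice
  of \<open>2 * \<tau>\<close>: only odd powers of \<open>q_of \<tau>\<close> occur, so no factor
  has to be split off.\<close>

lemma theta_shifted_fifths:
  assumes \<tau>: "Im \<tau> > 0"
  shows "theta (2 * \<tau>) (1 / 5 + \<tau>) * theta (2 * \<tau>) (2 / 5 + \<tau>) * qpochhammer (q_of \<tau>) (q_of \<tau> ^ 2) * q_of \<tau>
    = eps5 * qpochhammer (q_of \<tau> ^ 5) (q_of \<tau> ^ 10)"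
proof -
  let ?q = "q_of \<tau>"
  have q: "norm (?q\<^sup>2) < 1" using \<tau> by (simp add: norm_power_less_1)
  have *: "q_of (2 * \<tau> - (1 / 5 + \<tau>)) = zeta5 ^ 4 * ?q" "q_of (2 * \<tau> - (2 / 5 + \<tau>)) = zeta5 ^ 3 * ?q"
    "q_of (1 / 5 + \<tau>) = zeta5 * ?q" "q_of (2 / 5 + \<tau>) = zeta5\<^sup>2 * ?q"
  proof -
    have "2 * \<tau> - (1 / 5 + \<tau>) = \<tau> - 1 / 5" "2 * \<tau> - (2 / 5 + \<tau>) = \<tau> - 2 / 5" by simp_all
    then show "q_of (2 * \<tau> - (1 / 5 + \<tau>)) = zeta5 ^ 4 * ?q" "q_of (2 * \<tau> - (2 / 5 + \<tau>)) = zeta5 ^ 3 * ?q"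
      by (simp_all only: q_of_diff_fifth)
  qed (simp_all only: q_of_add q_of_fifth)
  have "theta (2 * \<tau>) (1 / 5 + \<tau>) * theta (2 * \<tau>) (2 / 5 + \<tau>) =
      (exp (- (of_real pi * \<i> * (1 / 5 + \<tau>))) * exp (- (of_real pi * \<i> * (2 / 5 + \<tau>)))) *
      (qpochhammer (zeta5 * ?q) (?q\<^sup>2) * qpochhammer (zeta5\<^sup>2 * ?q) (?q\<^sup>2) * qpochhammer (zeta5 ^ 3 * ?q) (?q\<^sup>2) * qpochhammer (zeta5 ^ 4 * ?q) (?q\<^sup>2))"
    unfolding theta_def * q_of_numeral by (simp only: mult_ac)
  then show ?thesis unfolding exp_fifths using qpochhammer_zeta[OF q, of ?q]
    by (simp add: mult.assoc power_mult[symmetric])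
qed

lemma dtheta0_square: "(dtheta0 \<tau>)\<^sup>2 = - 4 * of_real pi ^ 2 * euler_prod (q_of \<tau>) ^ 4"
  by (simp add: dtheta0_def euler_prod_def power_mult_distrib flip: power_mult)

lemma fifths_notin_lattice:
  assumes "Im \<tau> > 0"
  shows "1 / 5 \<notin> lattice \<tau>" "2 / 5 \<notin> lattice \<tau>"
  using fifth_notin_lattice[OF assms, of 1] fifth_notin_lattice[OF assms, of 2] by simp_all

lemma theta_3_5: "Im \<tau> > 0 \<Longrightarrow> theta \<tau> (3 / 5) = theta \<tau> (2 / 5)"
  using theta_add_1[of \<tau> "- (2 / 5)"] by (simp add: theta_minus)

definition kappa5 :: complex where "kappa5 = 4 * of_real pi ^ 2 / fifth_const"

lemma kappa_nonzero: "kappa5 \<noteq> 0"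
  using fifth_const_nonzero by (simp add: kappa5_def)

text \<open>In \<open>wp_diff\<close> the numerator contains theta(3/5) = theta(2/5) and theta(-1/5)
  = -theta(1/5). What survives is the reciprocal of the product computed in
  \<open>theta_fifths\<close>.\<close>

lemma wp5_eq_eta5_quot:
  assumes \<tau>: "Im \<tau> > 0"
  shows "wp5 \<tau> = kappa5 * eta5_quot \<tau>"
proof -
  let ?a = "theta \<tau> (1 / 5)" and ?b = "theta \<tau> (2 / 5)"
  have nz: "?a \<noteq> 0" "?b \<noteq> 0" using theta_eq_0_iff[OF \<tau>] fifths_notin_lattice[OF \<tau>] by auto
  have "wp5 \<tau> = (dtheta0 \<tau>)\<^sup>2 * ?b * (- ?a) / (?a\<^sup>2 * ?b\<^sup>2)"
    using wp_diff[OF \<tau> fifths_notin_lattice[OF \<tau>]] theta_3_5[OF \<tau>] theta_minus[OF \<tau>, of "1 / 5"] by (simp add: wp5_def)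
  also have "\<dots> = 4 * of_real pi ^ 2 * euler_prod (q_of \<tau>) ^ 4 / (?a * ?b)"
    using nz unfolding dtheta0_square by (simp add: power2_eq_square)
  also have "?a * ?b = fifth_const * euler_prod (q_of \<tau> ^ 5) / euler_prod (q_of \<tau>)"
    using theta_fifths[OF \<tau>] euler_prod_nonzero[of "q_of \<tau>"] \<tau> by (simp add: eq_divide_eq)
  finally show ?thesis by (simp add: eta5_quot_def kappa5_def power_numeral_reduce)
qed

text \<open>The lattice of \<open>\<tau>\<close> consists of two cosets of the lattice of
  \<open>2 * \<tau>\<close>. Correspondingly \<open>theta \<tau>\<close> factors, up to an
  exponential that \<open>ddlog\<close> ignores, by sorting its factors by the parity of the
  exponent.\<close>

lemma wp_split:
  assumes \<tau>: "Im \<tau> > 0" and w: "w \<notin> lattice \<tau>"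
  shows "w \<notin> lattice (2 * \<tau>)" "w + \<tau> \<notin> lattice (2 * \<tau>)" "wp \<tau> w = wp (2 * \<tau>) w + wp (2 * \<tau>) (w + \<tau>)"
proof -
  let ?q = "q_of \<tau>"
  have q: "norm ?q < 1" and \<tau>2: "Im (2 * \<tau>) > 0" using \<tau> by simp_all
  have eq: "theta \<tau> w = exp (of_real pi * \<i> * \<tau>) * exp (of_real pi * \<i> * w) * (theta (2 * \<tau>) w * theta (2 * \<tau>) (w + \<tau>))" for w
  proof -
    have *: "q_of (2 * \<tau> - w) = ?q\<^sup>2 / q_of w" "q_of (w + \<tau>) = q_of w * ?q"
      "q_of (2 * \<tau> - (w + \<tau>)) = ?q / q_of w" "q_of (\<tau> - w) = ?q / q_of w"
      by (simp_all add: q_of_diff q_of_add q_of_numeral power2_eq_square)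
    have **: "exp (- (of_real pi * \<i> * w)) = exp (of_real pi * \<i> * \<tau>) * exp (of_real pi * \<i> * w) *
        (exp (- (of_real pi * \<i> * w)) * exp (- (of_real pi * \<i> * (w + \<tau>))))"
      by (simp add: algebra_simps flip: exp_add)
    show ?thesis unfolding theta_def * q_of_numeral
      using qpochhammer_split[OF q, of "q_of w"] qpochhammer_split[OF q, of "?q / q_of w"] **
      by (simp add: power2_eq_square mult_ac)
  qed
  have nz: "theta (2 * \<tau>) w \<noteq> 0" "theta (2 * \<tau>) (w + \<tau>) \<noteq> 0"
    using eq[of w] theta_eq_0_iff[OF \<tau>, of w] w by auto
  then show "w \<notin> lattice (2 * \<tau>)" "w + \<tau> \<notin> lattice (2 * \<tau>)" using theta_eq_0_iff[OF \<tau>2] by blast+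
  have h: "(\<lambda>w. theta (2 * \<tau>) w) holomorphic_on UNIV" "(\<lambda>w. theta (2 * \<tau>) (w + \<tau>)) holomorphic_on UNIV"
    by (intro holomorphic_theta[OF \<tau>2] holomorphic_intros)+
  have "wp \<tau> w = ddlog (\<lambda>w. exp (of_real pi * \<i> * \<tau>) * exp (of_real pi * \<i> * w) * (theta (2 * \<tau>) w * theta (2 * \<tau>) (w + \<tau>))) w"
    unfolding wp_def by (subst eq[abs_def]) (rule refl)
  also have "\<dots> = ddlog (\<lambda>w. exp (of_real pi * \<i> * \<tau>) * exp (of_real pi * \<i> * w)) w
      + (ddlog (\<lambda>w. theta (2 * \<tau>) w) w + ddlog (\<lambda>w. theta (2 * \<tau>) (w + \<tau>)) w)"
    by (subst ddlog_mult, (intro holomorphic_intros h)+, use nz in simp, use nz in simp, subst ddlog_mult)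
       (use nz h in auto)
  also have "\<dots> = wp (2 * \<tau>) w + wp (2 * \<tau>) (w + \<tau>)"
    using ddlog_exp[of "exp (of_real pi * \<i> * \<tau>)"] ddlog_compose[OF h(1), of 1 \<tau> w] by (simp add: wp_def)
  finally show "wp \<tau> w = wp (2 * \<tau>) w + wp (2 * \<tau>) (w + \<tau>)" .
qed

lemma euler_prod_split:
  assumes "norm q < 1"
  shows "euler_prod q = qpochhammer q (q\<^sup>2) * euler_prod (q\<^sup>2)"
  using qpochhammer_split[OF assms, of q] by (simp add: euler_prod_def power2_eq_square)

text \<open>Subtracting \<open>wp_split\<close> at 1/5 and 2/5, the unshifted terms form
  \<open>wp5 (2 * \<tau>)\<close>. The shifted terms are evaluated by \<open>wp_diff\<close> and
  become products through \<open>theta_shifted_fifths\<close>.\<close>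

lemma eta5_quot_diff:
  assumes \<tau>: "Im \<tau> > 0"
  defines "q \<equiv> q_of \<tau>"
  shows "eta5_quot (2 * \<tau>) - eta5_quot \<tau> = 5 * q * euler_prod (q ^ 2) * euler_prod q ^ 2 * euler_prod (q ^ 10) ^ 3 / euler_prod (q ^ 5) ^ 2"
proof -
  have q: "norm q < 1" and \<tau>2: "Im (2 * \<tau>) > 0" using \<tau> by (simp_all add: q_def)
  note qk = norm_power_less_1[OF q]
  let ?a = "theta (2 * \<tau>) (1 / 5)" and ?b = "theta (2 * \<tau>) (2 / 5)"
  let ?c = "theta (2 * \<tau>) (1 / 5 + \<tau>)" and ?d = "theta (2 * \<tau>) (2 / 5 + \<tau>)"
  note s1 = wp_split[OF \<tau> fifths_notin_lattice(1)[OF \<tau>]] and s2 = wp_split[OF \<tau> fifths_notin_lattice(2)[OF \<tau>]]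
  have ab: "?a * ?b * euler_prod (q\<^sup>2) = fifth_const * euler_prod (q ^ 10)"
    using theta_fifths[OF \<tau>2] by (simp add: q_of_numeral q_def flip: power_mult)
  have cd: "?c * ?d * qpochhammer q (q\<^sup>2) * q = eps5 * qpochhammer (q ^ 5) (q ^ 10)"
    using theta_shifted_fifths[OF \<tau>] by (simp add: q_def)
  have q5: "euler_prod (q ^ 5) = qpochhammer (q ^ 5) (q ^ 10) * euler_prod (q ^ 10)"
    using euler_prod_split[OF qk[of 5]] by (simp flip: power_mult)
  have nz: "euler_prod q \<noteq> 0" "euler_prod (q\<^sup>2) \<noteq> 0" "euler_prod (q ^ 5) \<noteq> 0" "euler_prod (q ^ 10) \<noteq> 0"
    by (simp_all add: euler_prod_nonzero q qk)
  have nz2: "q \<noteq> 0" "qpochhammer q (q\<^sup>2) \<noteq> 0" "qpochhammer (q ^ 5) (q ^ 10) \<noteq> 0"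
    using nz euler_prod_split[OF q] q5 by (auto simp: q_def)
  have nz3: "?c \<noteq> 0" "?d \<noteq> 0" "eps5 \<noteq> 0" "zeta5 \<noteq> 0"
    using theta_eq_0_iff[OF \<tau>2] s1(2) s2(2) by (auto simp: eps5_def zeta5_def)
  \<comment> \<open>The two half-period shifts add up to the full period \<open>2 * \<tau>\<close>,
    so quasi-periodicity returns to 3/5.\<close>
  have "theta (2 * \<tau>) (1 / 5 + \<tau> + (2 / 5 + \<tau>)) = theta (2 * \<tau>) (3 / 5 + 2 * \<tau>)" by simp
  also have "\<dots> = - inverse q * inverse (zeta5 ^ 3) * ?b"
    using theta_add_tau[OF \<tau>2, of "3 / 5"] theta_3_5[OF \<tau>2] q_of_mult_nat[of 3 "1 / 5"]
    by (simp add: q_def q_of_fifth q_of_def[of \<tau>] exp_minus mult_ac)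
  also have "inverse (zeta5 ^ 3) = zeta5\<^sup>2" by (metis inverse_zeta(2) inverse_inverse_eq)
  finally have e1: "theta (2 * \<tau>) (1 / 5 + \<tau> + (2 / 5 + \<tau>)) = - inverse q * zeta5\<^sup>2 * ?b" .
  have e2: "theta (2 * \<tau>) (1 / 5 + \<tau> - (2 / 5 + \<tau>)) = - ?a"
    using theta_minus[OF \<tau>2, of "1 / 5"] by simp
  have "wp5 \<tau> - wp5 (2 * \<tau>) = wp (2 * \<tau>) (1 / 5 + \<tau>) - wp (2 * \<tau>) (2 / 5 + \<tau>)"
    by (simp add: wp5_def s1(3) s2(3))
  also have "\<dots> = (dtheta0 (2 * \<tau>))\<^sup>2 * zeta5\<^sup>2 * (?a * ?b) / (q * (?c * ?d)\<^sup>2)"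
    unfolding wp_diff[OF \<tau>2 s1(2) s2(2)] e1 e2 by (simp add: field_simps)
  also have "?a * ?b = fifth_const * euler_prod (q ^ 10) / euler_prod (q\<^sup>2)" using ab nz by (simp add: eq_divide_eq)
  also have "?c * ?d = eps5 * qpochhammer (q ^ 5) (q ^ 10) / (qpochhammer q (q\<^sup>2) * q)" using cd nz2 by (simp add: eq_divide_eq mult_ac)
  also have "(dtheta0 (2 * \<tau>))\<^sup>2 = - 4 * of_real pi ^ 2 * euler_prod (q\<^sup>2) ^ 4"
    unfolding dtheta0_square q_of_numeral q_def ..
  also have "- 4 * of_real pi ^ 2 * euler_prod (q\<^sup>2) ^ 4 * zeta5\<^sup>2 * (fifth_const * euler_prod (q ^ 10) / euler_prod (q\<^sup>2)) /
      (q * (eps5 * qpochhammer (q ^ 5) (q ^ 10) / (qpochhammer q (q\<^sup>2) * q))\<^sup>2)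
      = - kappa5 * (fifth_const\<^sup>2 * q * euler_prod (q\<^sup>2) ^ 3 * euler_prod (q ^ 10) * qpochhammer q (q\<^sup>2) ^ 2 / qpochhammer (q ^ 5) (q ^ 10) ^ 2)"
    unfolding power_mult_distrib power_divide epsilon_square kappa5_def using nz nz2 nz3 fifth_const_nonzero
    by (simp add: field_simps eval_nat_numeral)
  finally have "kappa5 * (eta5_quot (2 * \<tau>) - eta5_quot \<tau>) =
      kappa5 * (5 * q * euler_prod (q\<^sup>2) ^ 3 * euler_prod (q ^ 10) * qpochhammer q (q\<^sup>2) ^ 2 / qpochhammer (q ^ 5) (q ^ 10) ^ 2)"
    unfolding wp5_eq_eta5_quot[OF \<tau>] wp5_eq_eta5_quot[OF \<tau>2] fifth_const_square by (simp add: algebra_simps)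
  then have "eta5_quot (2 * \<tau>) - eta5_quot \<tau> = 5 * q * euler_prod (q\<^sup>2) ^ 3 * euler_prod (q ^ 10) * qpochhammer q (q\<^sup>2) ^ 2 / qpochhammer (q ^ 5) (q ^ 10) ^ 2"
    using kappa_nonzero by (simp only: mult_cancel_left) simp
  also have "\<dots> = 5 * q * euler_prod (q ^ 2) * euler_prod q ^ 2 * euler_prod (q ^ 10) ^ 3 / euler_prod (q ^ 5) ^ 2"
  proof -
    have "5 * q * b ^ 3 * t * r\<^sup>2 / s\<^sup>2 = 5 * q * b * (r * b)\<^sup>2 * t ^ 3 / (s * t)\<^sup>2"
      if "t \<noteq> 0" "s \<noteq> 0" for b t r s :: complex
      using that by (simp add: field_simps eval_nat_numeral)
    from this[OF nz(4) nz2(3)] show ?thesis unfolding q5 euler_prod_split[OF q] .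
  qed
  finally show ?thesis .
qed

section \<open>The cubic relation\<close>

text \<open>Factors with an even power of \<open>q\<close> agree for \<open>q\<close> and
  \<open>- q\<close>; those with an odd power pair off as differences of squares. The second version
  starts at the first power of \<open>q\<close> and fits the second product in
  \<open>theta\<close>.\<close>

lemma qpochhammer_halving:
  assumes q: "norm q < 1"
  shows "qpochhammer u q * qpochhammer u (- q) * qpochhammer (u\<^sup>2) (q ^ 4) = qpochhammer u (q\<^sup>2) * qpochhammer u (q\<^sup>2) * qpochhammer (u\<^sup>2) (q\<^sup>2)"
    and "qpochhammer (u * q) q * qpochhammer (- (u * q)) (- q) * qpochhammer (u\<^sup>2 * q ^ 4) (q ^ 4)
      = qpochhammer (u * q\<^sup>2) (q\<^sup>2) * qpochhammer (u * q\<^sup>2) (q\<^sup>2) * qpochhammer (u\<^sup>2 * q\<^sup>2) (q\<^sup>2)"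
proof -
  have q': "norm (- q) < 1" and q2: "norm (q\<^sup>2) < 1" using q norm_power_less_1[OF q] by simp_all
  have m: "qpochhammer (u * q) (q\<^sup>2) * qpochhammer (- (u * q)) (q\<^sup>2) = qpochhammer (u\<^sup>2 * q\<^sup>2) (q ^ 4)"
    using qpochhammer_mult_minus[OF q2, of "u * q"] by (simp add: power_mult_distrib flip: power_mult)
  have *: "qpochhammer u q = qpochhammer u (q\<^sup>2) * qpochhammer (u * q) (q\<^sup>2)" "qpochhammer u (- q) = qpochhammer u (q\<^sup>2) * qpochhammer (- (u * q)) (q\<^sup>2)"
    "qpochhammer (u\<^sup>2) (q\<^sup>2) = qpochhammer (u\<^sup>2) (q ^ 4) * qpochhammer (u\<^sup>2 * q\<^sup>2) (q ^ 4)"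
    using qpochhammer_split[OF q, of u] qpochhammer_split[OF q', of u] qpochhammer_split[OF q2, of "u\<^sup>2"] by (simp_all flip: power_mult)
  show "qpochhammer u q * qpochhammer u (- q) * qpochhammer (u\<^sup>2) (q ^ 4) = qpochhammer u (q\<^sup>2) * qpochhammer u (q\<^sup>2) * qpochhammer (u\<^sup>2) (q\<^sup>2)"
    unfolding * m[symmetric] by (simp only: mult_ac)
  have *: "qpochhammer (u * q) q = qpochhammer (u * q) (q\<^sup>2) * qpochhammer (u * q\<^sup>2) (q\<^sup>2)"
    "qpochhammer (- (u * q)) (- q) = qpochhammer (- (u * q)) (q\<^sup>2) * qpochhammer (u * q\<^sup>2) (q\<^sup>2)"
    "qpochhammer (u\<^sup>2 * q\<^sup>2) (q\<^sup>2) = qpochhammer (u\<^sup>2 * q\<^sup>2) (q ^ 4) * qpochhammer (u\<^sup>2 * q ^ 4) (q ^ 4)"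
    using qpochhammer_split[OF q, of "u * q"] qpochhammer_split[OF q', of "- (u * q)"] qpochhammer_split[OF q2, of "u\<^sup>2 * q\<^sup>2"]
    by (simp_all add: power2_eq_square[of q, symmetric] mult.assoc flip: power_mult power_add)
  show "qpochhammer (u * q) q * qpochhammer (- (u * q)) (- q) * qpochhammer (u\<^sup>2 * q ^ 4) (q ^ 4)
      = qpochhammer (u * q\<^sup>2) (q\<^sup>2) * qpochhammer (u * q\<^sup>2) (q\<^sup>2) * qpochhammer (u\<^sup>2 * q\<^sup>2) (q\<^sup>2)"
    unfolding * m[symmetric] by (simp only: mult_ac)
qed

lemma euler_prod_halving:
  assumes "norm q < 1"
  shows "euler_prod q * euler_prod (- q) * euler_prod (q ^ 4) = euler_prod (q\<^sup>2) ^ 3"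
  using qpochhammer_halving(2)[OF assms, of 1] by (simp add: euler_prod_def power3_eq_cube)

lemma q_of_add_half: "q_of (\<tau> + 1 / 2) = - q_of \<tau>"
  by (simp add: q_of_add q_of_half)

lemma eta5_quot_halving:
  assumes \<tau>: "Im \<tau> > 0"
  shows "eta5_quot \<tau> * eta5_quot (\<tau> + 1 / 2) * eta5_quot (4 * \<tau>) = eta5_quot (2 * \<tau>) ^ 3"
proof -
  have q: "norm (q_of \<tau>) < 1" using \<tau> by simp
  have "eta5_quot \<tau> * eta5_quot (\<tau> + 1 / 2) * eta5_quot (4 * \<tau>) = (euler_prod (q_of \<tau>) * euler_prod (- q_of \<tau>) * euler_prod (q_of \<tau> ^ 4)) ^ 5
      / (euler_prod (q_of \<tau> ^ 5) * euler_prod (- (q_of \<tau> ^ 5)) * euler_prod ((q_of \<tau> ^ 5) ^ 4))"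
    by (simp add: eta5_quot_def q_of_add_half q_of_numeral power_mult_distrib flip: power_mult)
  also have "\<dots> = eta5_quot (2 * \<tau>) ^ 3"
    unfolding euler_prod_halving[OF q] euler_prod_halving[OF norm_power_less_1[OF q zero_less_numeral]]
    by (simp add: eta5_quot_def q_of_numeral power_divide flip: power_mult)
  finally show ?thesis .
qed

text \<open>The halving identities combine into a product identity for \<open>theta\<close>, to
  which \<open>ddlog\<close> is applied; each coefficient 4 comes from doubling the argument. The
  condition on \<open>w\<close> covers all the lattices involved.\<close>

lemma wp_halving:
  assumes \<tau>: "Im \<tau> > 0" and w: "\<And>\<tau>. Im \<tau> > 0 \<Longrightarrow> w \<notin> lattice \<tau> \<and> 2 * w \<notin> lattice \<tau>"
  shows "wp \<tau> w + wp (\<tau> + 1 / 2) w + 4 * wp (4 * \<tau>) (2 * w) = 2 * wp (2 * \<tau>) w + 4 * wp (2 * \<tau>) (2 * w)"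
proof -
  let ?q = "q_of \<tau>"
  have q: "norm ?q < 1" and \<tau>h: "Im (\<tau> + 1 / 2) > 0" and \<tau>4: "Im (4 * \<tau>) > 0" and \<tau>2: "Im (2 * \<tau>) > 0"
    using \<tau> by simp_all
  have eq: "theta \<tau> w * (theta (\<tau> + 1 / 2) w * theta (4 * \<tau>) (2 * w)) = theta (2 * \<tau>) w * (theta (2 * \<tau>) w * theta (2 * \<tau>) (2 * w))" for w
  proof -
    let ?u = "inverse (q_of w)"
    have *: "q_of (\<tau> - w) = ?u * ?q" "q_of (\<tau> + 1 / 2 - w) = - (?u * ?q)" "q_of (4 * \<tau> - 2 * w) = ?u\<^sup>2 * ?q ^ 4"
      "q_of (2 * \<tau> - w) = ?u * ?q\<^sup>2" "q_of (2 * \<tau> - 2 * w) = ?u\<^sup>2 * ?q\<^sup>2"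
      unfolding q_of_diff q_of_add_half q_of_numeral by (simp_all add: field_simps)
    have ac: "e * p1 * p2 * (e * p3 * p4 * (e' * p5 * p6)) = e * e * e' * (p1 * p3 * p5) * (p2 * p4 * p6)"
      for e e' p1 p2 p3 p4 p5 p6 :: complex by (simp only: mult_ac)
    show ?thesis unfolding theta_def * q_of_numeral q_of_add_half ac
      unfolding qpochhammer_halving(1)[OF q, of "q_of w"] qpochhammer_halving(2)[OF q, of ?u] ..
  qed
  have h: "(\<lambda>w. theta \<tau>' w) holomorphic_on UNIV" "(\<lambda>w. theta \<tau>' (2 * w)) holomorphic_on UNIV"
      "(\<lambda>w. theta \<tau>'' w * theta \<tau>' (2 * w)) holomorphic_on UNIV"
    if "Im \<tau>' > 0" "Im \<tau>'' > 0" for \<tau>' \<tau>''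
    using that by (intro holomorphic_theta holomorphic_intros; simp)+
  have nz: "theta \<tau>' w \<noteq> 0" "theta \<tau>' (2 * w) \<noteq> 0" if "Im \<tau>' > 0" for \<tau>'
    using w[OF that] theta_eq_0_iff[OF that] by auto
  have *: "ddlog (\<lambda>w. theta \<tau>1 w * (theta \<tau>2 w * theta \<tau>3 (2 * w))) w = wp \<tau>1 w + (wp \<tau>2 w + 4 * wp \<tau>3 (2 * w))"
    if t: "Im \<tau>1 > 0" "Im \<tau>2 > 0" "Im \<tau>3 > 0" for \<tau>1 \<tau>2 \<tau>3
  proof -
    have "ddlog (\<lambda>w. theta \<tau>3 (2 * w)) w = 4 * wp \<tau>3 (2 * w)"
      using ddlog_compose[OF entire_theta[OF t(3)], of 2 0 w] by (simp add: wp_def)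
    moreover have "ddlog (\<lambda>w. theta \<tau>2 w * theta \<tau>3 (2 * w)) w = wp \<tau>2 w + ddlog (\<lambda>w. theta \<tau>3 (2 * w)) w"
      unfolding wp_def by (rule ddlog_mult) (use h t nz in auto)
    moreover have "ddlog (\<lambda>w. theta \<tau>1 w * (theta \<tau>2 w * theta \<tau>3 (2 * w))) w = wp \<tau>1 w + ddlog (\<lambda>w. theta \<tau>2 w * theta \<tau>3 (2 * w)) w"
      unfolding wp_def by (rule ddlog_mult) (use h t nz in auto)
    ultimately show ?thesis by simp
  qed
  show ?thesis
    using *[OF \<tau> \<tau>h \<tau>4] *[OF \<tau>2 \<tau>2 \<tau>2] unfolding eq by simp
qed

text \<open>Doubling sends 1/5 to 2/5, and 2/5 to 4/5, which is equivalent to 1/5 up to sign and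
  period. The doubled terms thus enter the difference with reversed sign.\<close>

lemma wp5_halving:
  assumes \<tau>: "Im \<tau> > 0"
  shows "wp5 \<tau> + wp5 (\<tau> + 1 / 2) = 4 * wp5 (4 * \<tau>) - 2 * wp5 (2 * \<tau>)"
proof -
  have 4: "wp \<tau>' (4 / 5) = wp \<tau>' (1 / 5)" "4 / 5 \<notin> lattice \<tau>'" if "Im \<tau>' > 0" for \<tau>'
    using wp_fifth[of \<tau>' 1 4 1] fifth_notin_lattice[of \<tau>' 4] that by simp_all
  have \<tau>s: "Im (2 * \<tau>) > 0" "Im (4 * \<tau>) > 0" using \<tau> by simp_all
  have a: "wp \<tau> (1 / 5) + wp (\<tau> + 1 / 2) (1 / 5) + 4 * wp (4 * \<tau>) (2 / 5)
      = 2 * wp (2 * \<tau>) (1 / 5) + 4 * wp (2 * \<tau>) (2 / 5)"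
    using wp_halving[OF \<tau>, of "1 / 5"] fifths_notin_lattice by simp
  have b: "wp \<tau> (2 / 5) + wp (\<tau> + 1 / 2) (2 / 5) + 4 * wp (4 * \<tau>) (1 / 5)
      = 2 * wp (2 * \<tau>) (2 / 5) + 4 * wp (2 * \<tau>) (1 / 5)"
    using wp_halving[OF \<tau>, of "2 / 5"] fifths_notin_lattice(2) 4(2) 4(1)[OF \<tau>s(1)] 4(1)[OF \<tau>s(2)] by simp
  show ?thesis using arg_cong2[OF a b, of "(-)"] by (simp add: wp5_def algebra_simps)
qed

text \<open>Eliminates the value at \<open>\<tau> + 1 / 2\<close> between the linear relation
  \<open>wp5_halving\<close> and the multiplicative relation
  \<open>eta5_quot_halving\<close>.\<close>

lemma eta5_quot_cubic:
  assumes \<tau>: "Im \<tau> > 0"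
  shows "eta5_quot (2 * \<tau>) ^ 3 = eta5_quot \<tau> * eta5_quot (4 * \<tau>) * (4 * eta5_quot (4 * \<tau>) - 2 * eta5_quot (2 * \<tau>) - eta5_quot \<tau>)"
proof -
  have \<tau>s: "Im (2 * \<tau>) > 0" "Im (4 * \<tau>) > 0" "Im (\<tau> + 1 / 2) > 0" using \<tau> by simp_all
  have "kappa5 * (eta5_quot \<tau> + eta5_quot (\<tau> + 1 / 2)) = kappa5 * (4 * eta5_quot (4 * \<tau>) - 2 * eta5_quot (2 * \<tau>))"
    using wp5_halving[OF \<tau>] unfolding wp5_eq_eta5_quot[OF \<tau>] wp5_eq_eta5_quot[OF \<tau>s(1)] wp5_eq_eta5_quot[OF \<tau>s(2)] wp5_eq_eta5_quot[OF \<tau>s(3)]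
    by (simp add: algebra_simps)
  then have "eta5_quot \<tau> + eta5_quot (\<tau> + 1 / 2) = 4 * eta5_quot (4 * \<tau>) - 2 * eta5_quot (2 * \<tau>)"
    using kappa_nonzero by simp
  then have "eta5_quot (\<tau> + 1 / 2) = 4 * eta5_quot (4 * \<tau>) - 2 * eta5_quot (2 * \<tau>) - eta5_quot \<tau>" by (simp add: algebra_simps)
  then show ?thesis using eta5_quot_halving[OF \<tau>] by (simp add: mult_ac)
qed

section \<open>The action of W\<close>

lemma qpoch_euler_prod: "qpoch k k q = euler_prod (q ^ k)"
  by (simp add: qpoch_eq_qpochhammer euler_prod_def)

lemma x_fun_eq:
  assumes \<tau>: "Im \<tau> > 0"
  shows "x_fun \<tau> = (eta5_quot (2 * \<tau>) - eta5_quot \<tau>) / (5 * eta5_quot \<tau>)"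
proof -
  have q: "norm (q_of \<tau>) < 1" using \<tau> by simp
  have nz: "euler_prod (q_of \<tau>) \<noteq> 0" "euler_prod (q_of \<tau> ^ 5) \<noteq> 0"
    by (simp_all add: euler_prod_nonzero norm_power_less_1 q)
  have "q * (b * t ^ 3) / (a ^ 3 * e) = (5 * q * b * a ^ 2 * t ^ 3 / e ^ 2) / (5 * (a ^ 5 / e))"
    if "a \<noteq> 0" "e \<noteq> 0" for a b e q t :: complex
    using that by (simp add: field_simps eval_nat_numeral)
  from this[OF nz] show ?thesis
    unfolding eta5_quot_diff[OF \<tau>] by (simp only: x_fun_def Let_def qpoch_euler_prod eta5_quot_def power_one_right)
qed

lemma y_fun_eq:
  assumes \<tau>: "Im \<tau> > 0"
  shows "y_fun \<tau> = (eta5_quot (4 * \<tau>) - eta5_quot (2 * \<tau>)) / (5 * eta5_quot \<tau>)"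
proof -
  have q: "norm (q_of \<tau>) < 1" and \<tau>2: "Im (2 * \<tau>) > 0" using \<tau> by simp_all
  have "eta5_quot (4 * \<tau>) - eta5_quot (2 * \<tau>) = 5 * q_of \<tau> ^ 2 * euler_prod (q_of \<tau> ^ 4) * euler_prod (q_of \<tau> ^ 2) ^ 2 * euler_prod (q_of \<tau> ^ 20) ^ 3 / euler_prod (q_of \<tau> ^ 10) ^ 2"
    using eta5_quot_diff[OF \<tau>2] by (simp add: q_of_numeral flip: power_mult)
  then show ?thesis
    by (simp add: y_fun_def Let_def qpoch_euler_prod eta5_quot_def mult_ac)
qed

text \<open>The three matrices have automorphy factors \<open>4 * s\<close>, \<open>2 * s\<close>
  and \<open>s\<close> at \<open>4 * \<tau>\<close>, \<open>2 * \<tau>\<close> and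
  \<open>\<tau>\<close>, whence 16, -4 and 1; the sign is the character value.\<close>

lemma eta5_quot_W:
  assumes \<tau>: "Im \<tau> > 0"
  defines "s \<equiv> 25 * \<tau> - 6"
  shows "s \<noteq> 0" "Im (W \<tau>) > 0"
    "eta5_quot (W \<tau>) = 16 * s\<^sup>2 * eta5_quot (4 * \<tau>)"
    "eta5_quot (2 * W \<tau>) = - 4 * s\<^sup>2 * eta5_quot (2 * \<tau>)"
    "eta5_quot (4 * W \<tau>) = s\<^sup>2 * eta5_quot \<tau>"
proof -
  have \<tau>2: "Im (2 * \<tau>) > 0" and \<tau>4: "Im (4 * \<tau>) > 0" using \<tau> by simp_all
  show s0: "s \<noteq> 0" using \<tau> by (auto simp: s_def complex_eq_iff)
  have m1: "W \<tau> = (4 * \<tau> - 1) / (4 * s)" by (simp add: W_def s_def)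
  have m2: "2 * W \<tau> = (4 * \<tau> - 1) / (2 * s)" and m4: "4 * W \<tau> = (4 * \<tau> - 1) / s"
    using s0 by (simp_all add: m1 field_simps)
  show pos: "Im (W \<tau>) > 0"
    using Im_moebius(2)[OF \<tau>4, of 1 "- 24" "- 1" 25 "4 * s" "W \<tau>"] by (simp add: m1) (simp add: s_def)
  then have pos2: "Im (2 * W \<tau>) > 0" and pos4: "Im (4 * W \<tau>) > 0" by simp_all
  have "wp5 (W \<tau>) = 16 * s\<^sup>2 * wp5 (4 * \<tau>)"
    using wp5_W[OF \<tau>4] by (simp add: m1 s_def algebra_simps power2_eq_square)
  then show "eta5_quot (W \<tau>) = 16 * s\<^sup>2 * eta5_quot (4 * \<tau>)"
    unfolding wp5_eq_eta5_quot[OF pos] wp5_eq_eta5_quot[OF \<tau>4] using kappa_nonzero by simp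
  have "wp5 (2 * W \<tau>) = - 4 * s\<^sup>2 * wp5 (2 * \<tau>)"
  proof -
    have "2 * W \<tau> = (2 * (2 * \<tau>) - 1) / (25 * (2 * \<tau>) - 12)" "25 * (2 * \<tau>) - 12 = 2 * s"
      by (simp_all add: m2 s_def)
    then show ?thesis using wp5_2W[OF \<tau>2] by (simp add: power_mult_distrib)
  qed
  then show "eta5_quot (2 * W \<tau>) = - 4 * s\<^sup>2 * eta5_quot (2 * \<tau>)"
  proof -
    assume "wp5 (2 * W \<tau>) = - 4 * s\<^sup>2 * wp5 (2 * \<tau>)"
    then have "kappa5 * eta5_quot (2 * W \<tau>) = kappa5 * (- 4 * s\<^sup>2 * eta5_quot (2 * \<tau>))"
      unfolding wp5_eq_eta5_quot[OF pos2] wp5_eq_eta5_quot[OF \<tau>2] by simp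
    then show ?thesis using kappa_nonzero by (simp only: mult_cancel_left) simp
  qed
  have "wp5 (4 * W \<tau>) = s\<^sup>2 * wp5 \<tau>"
    using wp5_4W[OF \<tau>] by (simp add: m4 s_def)
  then show "eta5_quot (4 * W \<tau>) = s\<^sup>2 * eta5_quot \<tau>"
    unfolding wp5_eq_eta5_quot[OF pos4] wp5_eq_eta5_quot[OF \<tau>] using kappa_nonzero by simp
qed

lemma x_y_W:
  assumes \<tau>: "Im \<tau> > 0"
  defines "x \<equiv> x_fun \<tau>" and "y \<equiv> y_fun \<tau>"
  shows "x_fun (W \<tau>) = - ((1 + 10 * x + 20 * x\<^sup>2 + 4 * y) / (4 * (1 + 5 * x)\<^sup>2))"
    and "1 / (1 + 5 * x_fun (W \<tau>)) = - (4 * (1 + 5 * x + 5 * y) / (1 + 5 * x))"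
    and "y_fun (W \<tau>) = (1 + 4 * x) * (1 + 10 * x + 20 * y) / (16 * (1 + 5 * x) ^ 3)"
proof -
  define s where "s = 25 * \<tau> - 6"
  \<comment> \<open>By the linear relation, \<open>d\<close> is the value of
    \<open>eta5_quot\<close> at \<open>\<tau> + 1 / 2\<close>.\<close>
  define a b c d where "a = eta5_quot \<tau>" and "b = eta5_quot (2 * \<tau>)" and "c = eta5_quot (4 * \<tau>)" and "d = 4 * c - 2 * b - a"
  have nz: "a \<noteq> 0" "b \<noteq> 0" "c \<noteq> 0" "s \<noteq> 0"
    using \<tau> eta5_quot_W(1)[OF \<tau>] by (simp_all add: a_def b_def c_def s_def eta5_quot_nonzero)
  have cubic: "b ^ 3 = a * c * d"
    using eta5_quot_cubic[OF \<tau>] by (simp add: a_def b_def c_def d_def)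
  have x: "x = (b - a) / (5 * a)" and y: "y = (c - b) / (5 * a)"
    using x_fun_eq[OF \<tau>] y_fun_eq[OF \<tau>] by (simp_all add: x_def y_def a_def b_def c_def)
  have X: "x_fun (W \<tau>) = - ((b + 4 * c) / (20 * c))" and Y: "y_fun (W \<tau>) = (a + 4 * b) / (80 * c)"
    unfolding x_fun_eq[OF eta5_quot_W(2)[OF \<tau>]] y_fun_eq[OF eta5_quot_W(2)[OF \<tau>]] eta5_quot_W(3-5)[OF \<tau>]
    unfolding a_def[symmetric] b_def[symmetric] c_def[symmetric] s_def[symmetric]
    using nz by (simp_all add: field_simps)
  have 1: "1 + 5 * x = b / a" "1 + 5 * x + 5 * y = c / a" "1 + 4 * x = (a + 4 * b) / (5 * a)"
    "1 + 10 * x + 20 * y = d / a" "1 + 10 * x + 20 * x\<^sup>2 + 4 * y = (4 * b\<^sup>2 + a * d) / (5 * a\<^sup>2)"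
    using nz by (simp_all add: x y d_def field_simps power2_eq_square)
  show "x_fun (W \<tau>) = - ((1 + 10 * x + 20 * x\<^sup>2 + 4 * y) / (4 * (1 + 5 * x)\<^sup>2))"
  proof -
    \<comment> \<open>The two sides differ by exactly \<open>b ^ 3 - a * c * d\<close>.\<close>
    have "(b + 4 * c) * b\<^sup>2 = (4 * b\<^sup>2 + a * d) * c" using cubic by algebra
    then show ?thesis unfolding 1 X using nz by (simp add: field_simps)
  qed
  show "1 / (1 + 5 * x_fun (W \<tau>)) = - (4 * (1 + 5 * x + 5 * y) / (1 + 5 * x))"
  proof -
    have "1 + 5 * x_fun (W \<tau>) = - (b / (4 * c))" unfolding X using nz by (simp add: field_simps)
    then show ?thesis unfolding 1(2) unfolding 1(1) using nz by simp
  qed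
  \<comment> \<open>Replacing \<open>b ^ 3\<close> by \<open>a * c * d\<close> leaves a factor
    \<open>d\<close> to cancel; \<open>d = 0\<close> would force \<open>b = 0\<close>.\<close>
  show "y_fun (W \<tau>) = (1 + 4 * x) * (1 + 10 * x + 20 * y) / (16 * (1 + 5 * x) ^ 3)"
    unfolding 1 Y power_divide cubic using nz cubic
    by (cases "d = 0") (simp_all add: field_simps eval_nat_numeral)
qed

text \<open>The three formulas of \<open>x_y_W\<close> are raised to the powers \<open>j\<close>,
  \<open>m\<close> and \<open>n\<close> and multiplied; the one for
  \<open>1 + 5 * x_fun (W \<tau>)\<close> is taken in reciprocal form because that factor is a
  denominator of \<open>f\<close>.\<close>

theorem theorem6p1:
  fixes j m n :: nat and f :: "complex \<Rightarrow> complex" and \<tau> :: complex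
  assumes "j \<in> {0, 1}"
    and "f = (\<lambda>t. y_fun t ^ j * (x_fun t ^ m / (1 + 5 * x_fun t) ^ n))"
    and "Im \<tau> > 0"
  shows "f (W \<tau>) =
    (let x = x_fun \<tau>; y = y_fun \<tau> in
      (-1) ^ (m + n) * 4 powi (int n - 2 * int j - int m) *
      (((1 + 4 * x) ^ j * (1 + 10 * x + 20 * y) ^ j *
        (1 + 10 * x + 20 * x ^ 2 + 4 * y) ^ m * (1 + 5 * x + 5 * y) ^ n)
       / (1 + 5 * x) ^ (3 * j + 2 * m + n)))"
proof -
  have "(4::complex) powi (int n - 2 * int j - int m) = 4 powi (int n - int (2 * j) - int m)" by simp
  also have "\<dots> = 4 ^ n / 4 ^ (2 * j) / 4 ^ m"
    by (subst power_int_diff, simp)+ (simp only: power_int_of_nat)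
  finally have 4: "(4::complex) powi (int n - 2 * int j - int m) = 4 ^ n / 16 ^ j / 4 ^ m"
    by (simp add: power_mult)
  have *: "(P1 * P2 / (16 * D ^ 3)) ^ j * ((- (M / (4 * D\<^sup>2))) ^ m * (- (4 * N / D)) ^ n)
      = (-1) ^ (m + n) * (4 ^ n / 16 ^ j / 4 ^ m) * (P1 ^ j * P2 ^ j * M ^ m * N ^ n / D ^ (3 * j + 2 * m + n))"
    for P1 P2 M N D :: complex
    unfolding power_minus[of "M / _"] power_minus[of "_ / D"] power_divide power_mult_distrib power_add power_mult[symmetric]
    by (simp add: mult_ac)
  have "f (W \<tau>) = y_fun (W \<tau>) ^ j * (x_fun (W \<tau>) ^ m * (1 / (1 + 5 * x_fun (W \<tau>))) ^ n)"
    by (simp add: assms(2) power_divide)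
  then show ?thesis
    unfolding x_y_W(2)[OF assms(3)] unfolding x_y_W(1,3)[OF assms(3)] * 4 Let_def .
qed

end
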